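(* Let $M$ be a semisimple Frobenius manifold, calibrated by a calibration associated to its monodromy data $(\mu,R)$ at $z=0$, let $B\subset M^0$ be a sufficiently small flat chart, and let $\kappa\in\{1,\dots,n\}$ be such that multiplication by $\frac{\partial}{\partial v^\kappa}$ is invertible on $B$. Let $Y_{\rm formal}(\mathbf u;z)$ and $\hat Y_{\rm formal}(\mathbf u;z)$ be the normalized formal solutions at $z=\infty$ associated to $M$ and $S_\kappa(M)$ respectively. Then $$Y_{\rm formal}(\mathbf u;z)=\hat Y_{\rm formal}(\mathbf u;z).$$ Moreover, choosing for $S_\kappa(M)$ the same oriented admissible line as for $M$, the Stokes matrix and the central connection matrix of $S_\kappa(M)$ coincide with those of $M$.
   Context: **Frobenius manifold.** A Frobenius manifold of charge $D$ is a complex manifold $M$ with Frobenius algebra structures on $T_pM$, holomorphic in $p$ (commutative associative product $\cdot$, unity $e$, symmetric nondegenerate invariant form $\langle\,,\rangle$), such that: $\langle\,,\rangle$ is flat with Levi-Civita connection $\nabla$ and $\nabla e=0$; for $c(X,Y,Z)=\langle X\cdot Y,Z\rangle$, $\nabla c$ is a symmetric 4-tensor; there is an Euler vector field $E$ with $[E,X\cdot Y]-[E,X]\cdot Y-X\cdot[E,Y]=X\cdot Y$ and $E\langle X,Y\rangle-\langle[E,X],Y\rangle-\langle X,[E,Y]\rangle=(2-D)\langle X,Y\rangle$. It is semisimple if $T_pM$ has no nonzero nilpotents for generic $p$. **Coordinates.** $(B,\phi)$: flat chart with $\phi(B)$ a small ball, flat coordinates $\mathbf v=(v^1,\dots,v^n)$,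 $\frac{\partial}{\partial v^\iota}=e$, $\eta_{\alpha\beta}=\langle\frac{\partial}{\partial v^\alpha},\frac{\partial}{\partial v^\beta}\rangle$, $(\eta^{\alpha\beta})=\eta^{-1}$, $v_\alpha=\sum\eta_{\alpha\rho}v^\rho$, structure constants $c^\gamma_{\alpha\beta}$, $c_\alpha=(c_{\alpha\beta}^\gamma)$ the matrix of multiplication by $\frac{\partial}{\partial v^\alpha}$; $E=\sum_\beta E^\beta\frac{\partial}{\partial v^\beta}$, $E^\beta=(1-\frac D2-\mu_\beta)v^\beta+r^\beta$ with constants, $\mu_\iota=-\frac D2$, $r^\iota=0$; $\mu=\mathrm{diag}(\mu_\alpha)$; $\mathcal U^\alpha_\beta=\sum_\rho E^\rho c^\alpha_{\rho\beta}$. **Data at $z=0$ and calibration.** $(\mu,R)$ are monodromy data at $z=0$: $R=\sum_{s\ge1}R_s$ (finite), $z^\mu Rz^{-\mu}=\sum R_sz^s$, $\eta^{-1}R_s^T\eta=(-1)^{s+1}R_s$, and the system $\partial y/\partial v^\alpha=zc_\alpha y$, $dy/dz=(\mathcal U+\mu/z)y$ has a fundamental solution $\mathcal Y_0=\Theta(\mathbf v;z)z^\mu z^R$, $\Theta$ analytic on $B\times\mathbb C$, $\Theta(\mathbf v;0)=I$, $\eta^{-1}\Theta(\mathbf v;-z)^T\eta\Theta(\mathbf v;z)=I$. An associated calibration is a family $\theta_{\alpha,m}(\mathbf v)$ ($m\ge 0$), $\theta_\alpha=\sum_m\theta_{\alpha,m}z^m$, with $\theta_{\alpha,0}=v_\alpha$,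 $\frac{\partial^2\theta_{\gamma,m+1}}{\partial v^\alpha\partial v^\beta}=\sum_\sigma c^\sigma_{\alpha\beta}\frac{\partial\theta_{\gamma,m}}{\partial v^\sigma}$, $\langle\nabla\theta_\alpha(z),\nabla\theta_\beta(-z)\rangle=\eta_{\alpha\beta}$, $\frac{\partial\theta_{\alpha,m+1}}{\partial v^\iota}=\theta_{\alpha,m}$, $E(\frac{\partial\theta_{\alpha,m}}{\partial v^\beta})=(m+\mu_\alpha+\mu_\beta)\frac{\partial\theta_{\alpha,m}}{\partial v^\beta}+\sum_\gamma\sum_{k=1}^m(R_k)^\gamma_\alpha\frac{\partial\theta_{\gamma,m-k}}{\partial v^\beta}$; here $\Theta^\alpha_\beta=\sum_\gamma\eta^{\alpha\gamma}\frac{\partial\theta_\beta(\mathbf v;z)}{\partial v^\gamma}$. Two-point functions: $\sum_{m_1,m_2\ge0}\Omega^{M,[0]}_{\alpha,m_1;\beta,m_2}z^{m_1}w^{m_2}=\frac{\langle\nabla\theta_\alpha(z),\nabla\theta_\beta(w)\rangle-\eta_{\alpha\beta}}{z+w}$. **Canonical coordinates.** $M^0\subset M$ is the open set where the eigenvalues $u_1,\dots,u_n$ of $\mathcal U$ are pairwise distinct; there $\mathbf u=(u_1,\dots,u_n)$ are local coordinates, $\frac{\partial}{\partial u_i}\cdot\frac{\partial}{\partial u_j}=\delta_{ij}\frac{\partial}{\partial u_j}$ and $\langle\frac{\partial}{\partial u_i},\frac{\partial}{\partial u_j}\rangle=0$ for $i\ne j$. Put $\eta_{ii}(\mathbf u)=\langle\frac{\partial}{\partial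 u_i},\frac{\partial}{\partial u_i}\rangle$, $f_i=\eta_{ii}^{-1/2}\frac{\partial}{\partial u_i}$ (arbitrary fixed choice of signs of roots), $\Psi=(\psi_{i\alpha})$ with $\frac{\partial}{\partial v^\alpha}=\sum_i\psi_{i\alpha}f_i$, $U=\mathrm{diag}(u_1,\dots,u_n)$, $V=\Psi\mu\Psi^{-1}$ (antisymmetric), $(E_i)_{ab}=\delta_{ia}\delta_{ib}$, $V_i=\mathrm{ad}_U^{-1}([E_i,V])$, i.e. the off-diagonal matrix with $[U,V_i]=[E_i,V]$. Consider $$\frac{\partial Y}{\partial u_i}=(zE_i+V_i)Y,\qquad \frac{dY}{dz}=\Big(U+\frac Vz\Big)Y.\qquad( * )$$ $Y_{\rm formal}=\Phi(\mathbf u;z)e^{zU}$ is the unique formal solution of $( * )$ with $\Phi=\sum_{k\ge0}\Phi_k(\mathbf u)z^{-k}$, $\Phi_0=I$ and $\Phi(\mathbf u;-z)^T\Phi(\mathbf u;z)=I$. **Stokes and central connection matrices.** A line $\ell$ through $0\in\mathbb C$ is admissible if $\mathrm{Re}\,z(u_i-u_j)\ne0$ for $z\in\ell\setminus0$, $i\ne j$. Orient $\ell$, with positive ray $\arg z=\vartheta\in[0,2\pi)$. For small $\varepsilon>0$ let $\Pi_{\rm right}:\vartheta-\pi-\varepsilon<\arg z<\vartheta+\varepsilon$, $\Pi_{\rm left}:\vartheta-\varepsilon<\arg z<\vartheta+\pi+\varepsilon$, $\Pi_+:\vartheta-\varepsilon<\arg z<\vartheta+\varepsilon$. There are unique fundamental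 solutions $Y_{\rm right/left}$ of the $z$-equation in $( * )$, analytic in $\Pi_{\rm right/left}$ and asymptotic to $Y_{\rm formal}$ there as $|z|\to\infty$. The Stokes matrix $S$ is defined by $Y_{\rm left}=Y_{\rm right}S$ on $\Pi_+$, and the central connection matrix $C$ by $Y_{\rm right}=Y_0C$ on $\Pi_+$, where $Y_0=\Psi\mathcal Y_0$. Both are constant. **$S_\kappa(M)$.** $S_\kappa(M)=(B,\cdot,e,\langle\,,\rangle^\wedge,E)$ with $\langle x,y\rangle^\wedge=\langle\frac{\partial}{\partial v^\kappa}\cdot x,\frac{\partial}{\partial v^\kappa}\cdot y\rangle$, a Frobenius manifold of charge $-2\mu_\kappa$ with flat coordinates $\hat v^\alpha=\sum_\beta\eta^{\alpha\beta}\hat v_\beta$, $\hat v_\alpha=\Omega^{M,[0]}_{\alpha,0;\kappa,0}$, the same Gram matrix $\eta$, $e=\frac{\partial}{\partial\hat v^\kappa}$, the same $\mu,R$, and calibration $\hat\theta_{\alpha,m}=\Omega^{M,[0]}_{\alpha,m;\kappa,0}$. It has the same canonical coordinates $u_1,\dots,u_n$ (taken in the same order). For $S_\kappa(M)$ the orthonormal frame is chosen as $\hat f_i=\psi_{i\kappa}^{-1}\frac{\partial}{\partial u_i}$, $\hat\Psi=(\hat\psi_{i\alpha})$ is defined by $\frac{\partial}{\partial\hat v^\alpha}=\sum_i\hat\psi_{i\alpha}\hat f_i$, $\hat V=\hat\Psi\mu\hat\Psi^{-1}$, $\hat{\mathcal Y}_0=\hat\Theta z^\mu z^R$ with $\hat\Theta^\alpha_\beta=\sum_\gamma\eta^{\alpha\gamma}\frac{\partial\hat\theta_\beta}{\partial\hat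 v^\gamma}$, $\hat\theta_\beta=\sum_m\hat\theta_{\beta,m}z^m$. Put $\hat V_i=\mathrm{ad}_U^{-1}([E_i,\hat V])$, i.e. the off-diagonal matrix with $[U,\hat V_i]=[E_i,\hat V]$. Then $\hat Y_{\rm formal}=\hat\Phi(\mathbf u;z)e^{zU}$ is the unique formal solution of $\frac{\partial\hat Y}{\partial u_i}=(zE_i+\hat V_i)\hat Y$, $\frac{d\hat Y}{dz}=(U+\frac{\hat V}z)\hat Y$ with $\hat\Phi=\sum_{k\ge0}\hat\Phi_k(\mathbf u)z^{-k}$, $\hat\Phi_0=I$ and $\hat\Phi(\mathbf u;-z)^T\hat\Phi(\mathbf u;z)=I$. For an oriented admissible line $\ell$ with sectors $\Pi_{\rm right}$, $\Pi_{\rm left}$, $\Pi_+$, let $\hat Y_{\rm right/left}$ be the unique fundamental solutions of $\frac{d\hat Y}{dz}=(U+\frac{\hat V}z)\hat Y$ analytic in $\Pi_{\rm right/left}$ and asymptotic to $\hat Y_{\rm formal}$ there as $|z|\to\infty$. The Stokes matrix $\hat S$ of $S_\kappa(M)$ is defined by $\hat Y_{\rm left}=\hat Y_{\rm right}\hat S$ on $\Pi_+$, and the central connection matrix $\hat C$ of $S_\kappa(M)$ by $\hat Y_{\rm right}=\hat Y_0\hat C$ on $\Pi_+$, where $\hat Y_0=\hat\Psi\hat{\mathcal Y}_0$. *)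

theory Defs
  imports "HOL-Analysis.Analysis" "HOL-Library.Landau_Symbols"
begin

section \<open>Matrices\<close>

definition diag_matrix :: "complex^'n \<Rightarrow> complex^'n^'n" where
  "diag_matrix x = (\<chi> i j. if i = j then x $ i else 0)"

definition unit_matrix :: "'n \<Rightarrow> complex^'n^'n" where
  "unit_matrix i = (\<chi> a b. if a = i \<and> b = i then 1 else 0)"

definition scale_matrix :: "complex \<Rightarrow> complex^'n^'n \<Rightarrow> complex^'n^'n" where
  "scale_matrix k A = (\<chi> i j. k * A $ i $ j)"

primrec matrix_power :: "complex^'n^'n \<Rightarrow> nat \<Rightarrow> complex^'n^'n" where
  "matrix_power A 0 = mat 1"
| "matrix_power A (Suc k) = A ** matrix_power A k"

definition matrix_exp :: "complex^'n^'n \<Rightarrow> complex^'n^'n" where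
  "matrix_exp A = (\<chi> i j. \<Sum>k. matrix_power A k $ i $ j / fact k)"

text \<open>The inverse of \<open>A \<mapsto> [U, A]\<close> on off-diagonal matrices, for \<open>U = diag u\<close> with distinct entries.\<close>
definition ad_inv :: "complex^'n \<Rightarrow> complex^'n^'n \<Rightarrow> complex^'n^'n" where
  "ad_inv u A = (\<chi> a b. if a = b then 0 else A $ a $ b / (u $ a - u $ b))"


section \<open>Complex manifolds\<close>

text \<open>A chart is a pair of its domain and its coordinate map (a total function, of which only the
  restriction to the domain matters).\<close>
type_synonym ('m, 'n) chart = "'m set \<times> ('m \<Rightarrow> complex^'n)"

text \<open>Holomorphy in several variables, on an open set.\<close>
definition holo_on :: "(complex^'n::finite \<Rightarrow> complex) \<Rightarrow> (complex^'n) set \<Rightarrow> bool" where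
  "holo_on f S \<longleftrightarrow>
     (\<forall>x\<in>S. \<exists>D. (f has_derivative D) (at x) \<and> (\<forall>a h. D (a *s h) = a * D h))"

definition chart_inv :: "('m, 'n::finite) chart \<Rightarrow> complex^'n \<Rightarrow> 'm" where
  "chart_inv c = inv_into (fst c) (snd c)"

definition holo_chart :: "('m, 'n::finite) chart \<Rightarrow> ('m \<Rightarrow> complex) \<Rightarrow> bool" where
  "holo_chart c f \<longleftrightarrow> holo_on (f \<circ> chart_inv c) (snd c ` fst c)"

text \<open>\<open>pd c k f p\<close> is the partial derivative of \<open>f\<close> with respect to the \<open>k\<close>-th coordinate of the
  chart \<open>c\<close>, at the point \<open>p\<close> of its domain.\<close>
definition pd :: "('m, 'n::finite) chart \<Rightarrow> 'n \<Rightarrow> ('m \<Rightarrow> complex) \<Rightarrow> 'm \<Rightarrow> complex" where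
  "pd c k f p = deriv (\<lambda>t. f (chart_inv c (snd c p + axis k t))) 0"

definition is_chart :: "'m topology \<Rightarrow> ('m, 'n::finite) chart \<Rightarrow> bool" where
  "is_chart X c \<longleftrightarrow> openin X (fst c) \<and> open (snd c ` fst c) \<and>
     homeomorphic_map (subtopology X (fst c)) (top_of_set (snd c ` fst c)) (snd c)"

definition transition_holo :: "('m, 'n::finite) chart \<Rightarrow> ('m, 'n) chart \<Rightarrow> bool" where
  "transition_holo c d \<longleftrightarrow>
     (\<forall>j. holo_on (\<lambda>x. snd d (chart_inv c x) $ j) (snd c ` (fst c \<inter> fst d)))"

definition compatible :: "('m, 'n::finite) chart \<Rightarrow> ('m, 'n) chart \<Rightarrow> bool" where
  "compatible c d \<longleftrightarrow> transition_holo c d \<and> transition_holo d c"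

text \<open>The atlas is taken to be the maximal one.\<close>
definition complex_manifold :: "'m topology \<Rightarrow> ('m, 'n::finite) chart set \<Rightarrow> bool" where
  "complex_manifold X A \<longleftrightarrow>
     Hausdorff_space X \<and> second_countable X \<and> \<Union>(fst ` A) = topspace X \<and>
     (\<forall>c\<in>A. is_chart X c) \<and> (\<forall>c\<in>A. \<forall>d\<in>A. compatible c d) \<and>
     (\<forall>c. is_chart X c \<and> (\<forall>d\<in>A. compatible c d) \<longrightarrow> c \<in> A)"

definition jacobian :: "('m, 'n::finite) chart \<Rightarrow> ('m, 'n) chart \<Rightarrow> 'm \<Rightarrow> complex^'n^'n" where
  "jacobian c d p = (\<chi> j k. pd c k (\<lambda>q. snd d q $ j) p)"

text \<open>The components, in the chart \<open>d\<close>, of the coordinate vector field \<open>\<partial>/\<partial>x\<^sup>k\<close> of the chart \<open>c\<close>.\<close>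
definition coord_field :: "('m, 'n::finite) chart \<Rightarrow> 'n \<Rightarrow> ('m, 'n) chart \<Rightarrow> 'm \<Rightarrow> complex^'n" where
  "coord_field c k d p = column k (jacobian c d p)"


section \<open>Frobenius manifolds\<close>

text \<open>A tensor field is given by its components in each chart, subject to the transformation law
  \<open>tensorial\<close> below. \<open>sc F c p \<alpha>\<close> is the matrix of multiplication by \<open>\<partial>/\<partial>x\<^sup>\<alpha>\<close>, i.e.
  \<open>sc F c p \<alpha> $ \<gamma> $ \<beta>\<close> is the structure constant \<open>c\<^sup>\<gamma>\<^bsub>\<alpha>\<beta>\<^esub>\<close> in the chart \<open>c\<close>.\<close>
record ('m, 'n) frobenius_data =
  space_of :: "'m topology"
  charts :: "('m, 'n) chart set"
  sc :: "('m, 'n) chart \<Rightarrow> 'm \<Rightarrow> 'n \<Rightarrow> complex^'n^'n"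
  unity :: "('m, 'n) chart \<Rightarrow> 'm \<Rightarrow> complex^'n"
  metric :: "('m, 'n) chart \<Rightarrow> 'm \<Rightarrow> complex^'n^'n"
  euler :: "('m, 'n) chart \<Rightarrow> 'm \<Rightarrow> complex^'n"

definition mult :: "('m, 'n::finite) frobenius_data \<Rightarrow> ('m, 'n) chart \<Rightarrow> 'm
    \<Rightarrow> complex^'n \<Rightarrow> complex^'n \<Rightarrow> complex^'n" where
  "mult F c p X Y = (\<Sum>a\<in>UNIV. X $ a *s (sc F c p a *v Y))"

definition pairing :: "('m, 'n::finite) frobenius_data \<Rightarrow> ('m, 'n) chart \<Rightarrow> 'm
    \<Rightarrow> complex^'n \<Rightarrow> complex^'n \<Rightarrow> complex" where
  "pairing F c p X Y = (\<Sum>a\<in>UNIV. \<Sum>b\<in>UNIV. metric F c p $ a $ b * X $ a * Y $ b)"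

definition tensorial :: "('m, 'n::finite) frobenius_data \<Rightarrow> bool" where
  "tensorial F \<longleftrightarrow>
     (\<forall>c\<in>charts F. \<forall>d\<in>charts F. \<forall>p \<in> fst c \<inter> fst d. let J = jacobian c d p in
        unity F d p = J *v unity F c p \<and>
        euler F d p = J *v euler F c p \<and>
        (\<forall>X Y. mult F d p (J *v X) (J *v Y) = J *v mult F c p X Y) \<and>
        (\<forall>X Y. pairing F d p (J *v X) (J *v Y) = pairing F c p X Y))"

definition holomorphic_data :: "('m, 'n::finite) frobenius_data \<Rightarrow> ('m, 'n) chart \<Rightarrow> bool" where
  "holomorphic_data F c \<longleftrightarrow>
     (\<forall>a b g. holo_chart c (\<lambda>p. sc F c p a $ g $ b)) \<and>
     (\<forall>a. holo_chart c (\<lambda>p. unity F c p $ a)) \<and>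
     (\<forall>a b. holo_chart c (\<lambda>p. metric F c p $ a $ b)) \<and>
     (\<forall>a. holo_chart c (\<lambda>p. euler F c p $ a))"

definition frobenius_algebra ::
    "('m, 'n::finite) frobenius_data \<Rightarrow> ('m, 'n) chart \<Rightarrow> 'm \<Rightarrow> bool" where
  "frobenius_algebra F c p \<longleftrightarrow>
     (\<forall>X Y. mult F c p X Y = mult F c p Y X) \<and>
     (\<forall>X Y Z. mult F c p (mult F c p X Y) Z = mult F c p X (mult F c p Y Z)) \<and>
     (\<forall>X. mult F c p (unity F c p) X = X) \<and>
     (\<forall>X Y. pairing F c p X Y = pairing F c p Y X) \<and>
     (\<forall>X. (\<forall>Y. pairing F c p X Y = 0) \<longrightarrow> X = 0) \<and>
     (\<forall>X Y Z. pairing F c p (mult F c p X Y) Z = pairing F c p X (mult F c p Y Z))"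

text \<open>\<open>christoffel F c g a b p\<close> is \<open>\<Gamma>\<^sup>g\<^bsub>ab\<^esub>\<close> for the Levi-Civita connection of the metric.\<close>
definition christoffel :: "('m, 'n::finite) frobenius_data \<Rightarrow> ('m, 'n) chart
    \<Rightarrow> 'n \<Rightarrow> 'n \<Rightarrow> 'n \<Rightarrow> 'm \<Rightarrow> complex" where
  "christoffel F c g a b p = (\<Sum>d\<in>UNIV. matrix_inv (metric F c p) $ g $ d *
      (pd c a (\<lambda>q. metric F c q $ d $ b) p + pd c b (\<lambda>q. metric F c q $ d $ a) p
       - pd c d (\<lambda>q. metric F c q $ a $ b) p)) / 2"

definition riemann :: "('m, 'n::finite) frobenius_data \<Rightarrow> ('m, 'n) chart
    \<Rightarrow> 'n \<Rightarrow> 'n \<Rightarrow> 'n \<Rightarrow> 'n \<Rightarrow> 'm \<Rightarrow> complex" where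
  "riemann F c d g a b p =
     pd c a (christoffel F c d b g) p - pd c b (christoffel F c d a g) p
     + (\<Sum>e\<in>UNIV. christoffel F c d a e p * christoffel F c e b g p
                - christoffel F c d b e p * christoffel F c e a g p)"

definition nabla_vector :: "('m, 'n::finite) frobenius_data \<Rightarrow> ('m, 'n) chart
    \<Rightarrow> ('m \<Rightarrow> complex^'n) \<Rightarrow> 'n \<Rightarrow> 'n \<Rightarrow> 'm \<Rightarrow> complex" where
  "nabla_vector F c X a b p =
     pd c a (\<lambda>q. X q $ b) p + (\<Sum>g\<in>UNIV. christoffel F c b a g p * X p $ g)"

definition c_tensor :: "('m, 'n::finite) frobenius_data \<Rightarrow> ('m, 'n) chart
    \<Rightarrow> 'n \<Rightarrow> 'n \<Rightarrow> 'n \<Rightarrow> 'm \<Rightarrow> complex" where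
  "c_tensor F c a b g p = pairing F c p (mult F c p (axis a 1) (axis b 1)) (axis g 1)"

definition nabla_c :: "('m, 'n::finite) frobenius_data \<Rightarrow> ('m, 'n) chart
    \<Rightarrow> 'n \<Rightarrow> 'n \<Rightarrow> 'n \<Rightarrow> 'n \<Rightarrow> 'm \<Rightarrow> complex" where
  "nabla_c F c d a b g p = pd c d (c_tensor F c a b g) p
     - (\<Sum>e\<in>UNIV. christoffel F c e d a p * c_tensor F c e b g p
                + christoffel F c e d b p * c_tensor F c a e g p
                + christoffel F c e d g p * c_tensor F c a b e p)"

definition lie_bracket :: "('m, 'n::finite) chart \<Rightarrow> ('m \<Rightarrow> complex^'n) \<Rightarrow> ('m \<Rightarrow> complex^'n)
    \<Rightarrow> 'm \<Rightarrow> complex^'n" where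
  "lie_bracket c X Y p = (\<chi> g. \<Sum>s\<in>UNIV.
     X p $ s * pd c s (\<lambda>q. Y q $ g) p - Y p $ s * pd c s (\<lambda>q. X q $ g) p)"

definition vector_derivative_along :: "('m, 'n::finite) chart \<Rightarrow> ('m \<Rightarrow> complex^'n)
    \<Rightarrow> ('m \<Rightarrow> complex) \<Rightarrow> 'm \<Rightarrow> complex" where
  "vector_derivative_along c X f p = (\<Sum>s\<in>UNIV. X p $ s * pd c s f p)"

definition euler_axioms ::
    "('m, 'n::finite) frobenius_data \<Rightarrow> complex \<Rightarrow> ('m, 'n) chart \<Rightarrow> bool" where
  "euler_axioms F D c \<longleftrightarrow>
     (\<forall>X Y. (\<forall>a. holo_chart c (\<lambda>q. X q $ a)) \<and> (\<forall>a. holo_chart c (\<lambda>q. Y q $ a)) \<longrightarrow>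
       (\<forall>p\<in>fst c.
          lie_bracket c (euler F c) (\<lambda>q. mult F c q (X q) (Y q)) p
            - mult F c p (lie_bracket c (euler F c) X p) (Y p)
            - mult F c p (X p) (lie_bracket c (euler F c) Y p)
          = mult F c p (X p) (Y p) \<and>
          vector_derivative_along c (euler F c) (\<lambda>q. pairing F c q (X q) (Y q)) p
            - pairing F c p (lie_bracket c (euler F c) X p) (Y p)
            - pairing F c p (X p) (lie_bracket c (euler F c) Y p)
          = (2 - D) * pairing F c p (X p) (Y p)))"

definition frobenius_manifold :: "('m, 'n::finite) frobenius_data \<Rightarrow> complex \<Rightarrow> bool" where
  "frobenius_manifold F D \<longleftrightarrow>
     complex_manifold (space_of F) (charts F) \<and> tensorial F \<and>
     (\<forall>c\<in>charts F. holomorphic_data F c \<and> euler_axioms F D c \<and>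
       (\<forall>p\<in>fst c. frobenius_algebra F c p \<and>
         (\<forall>d g a b. riemann F c d g a b p = 0) \<and>
         (\<forall>a b. nabla_vector F c (unity F c) a b p = 0) \<and>
         (\<forall>d a b g. nabla_c F c d a b g p = nabla_c F c a d b g p \<and>
                    nabla_c F c d a b g p = nabla_c F c d b a g p \<and>
                    nabla_c F c d a b g p = nabla_c F c d a g b p)))"

text \<open>Genericity is read as validity on a dense open subset; \<open>((mult F c p X) ^^ k) X\<close> is the
  \<open>(k+1)\<close>-st power of \<open>X\<close>.\<close>
definition semisimple :: "('m, 'n::finite) frobenius_data \<Rightarrow> bool" where
  "semisimple F \<longleftrightarrow>
     (\<exists>W. openin (space_of F) W \<and> (space_of F) closure_of W = topspace (space_of F) \<and>
        (\<forall>p\<in>W. \<forall>c\<in>charts F. p \<in> fst c \<longrightarrow>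
           (\<forall>X k. ((mult F c p X) ^^ k) X = 0 \<longrightarrow> X = 0)))"

definition euler_eigenvalues ::
    "('m, 'n::finite) frobenius_data \<Rightarrow> ('m, 'n) chart \<Rightarrow> 'm \<Rightarrow> complex set" where
  "euler_eigenvalues F c p = {l. \<exists>X. X \<noteq> 0 \<and> mult F c p (euler F c p) X = l *s X}"

text \<open>The set \<open>M\<^sup>0\<close> of points where multiplication by \<open>E\<close> has pairwise distinct eigenvalues.\<close>
definition regular_part :: "('m, 'n::finite) frobenius_data \<Rightarrow> 'm set" where
  "regular_part F = {p \<in> topspace (space_of F).
     \<forall>c\<in>charts F. p \<in> fst c \<longrightarrow> card (euler_eigenvalues F c p) = CARD('n)}"


section \<open>Flat and canonical coordinates\<close>

definition flat_coordinates :: "('m, 'n::finite) frobenius_data \<Rightarrow> complex \<Rightarrow> ('m, 'n) chart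
    \<Rightarrow> 'n \<Rightarrow> complex^'n^'n \<Rightarrow> complex^'n \<Rightarrow> complex^'n \<Rightarrow> bool" where
  "flat_coordinates F D c \<iota> \<eta> \<mu> r \<longleftrightarrow>
     c \<in> charts F \<and> (\<exists>a \<rho>. 0 < \<rho> \<and> snd c ` fst c = ball a \<rho>) \<and>
     \<mu> $ \<iota> = - D / 2 \<and> r $ \<iota> = 0 \<and>
     (\<forall>p\<in>fst c. metric F c p = \<eta> \<and> unity F c p = axis \<iota> 1 \<and>
        (\<forall>\<beta>. euler F c p $ \<beta> = (1 - D / 2 - \<mu> $ \<beta>) * snd c p $ \<beta> + r $ \<beta>))"

text \<open>Canonical coordinates: the coordinate vector fields are idempotents, and the coordinates
  themselves are the eigenvalues of multiplication by \<open>E\<close>.\<close>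
definition canonical_coordinates ::
    "('m, 'n::finite) frobenius_data \<Rightarrow> ('m, 'n) chart \<Rightarrow> bool" where
  "canonical_coordinates F c \<longleftrightarrow> c \<in> charts F \<and>
     (\<forall>p\<in>fst c. euler_eigenvalues F c p = range (\<lambda>i. snd c p $ i) \<and>
        (\<forall>i j. mult F c p (axis i 1) (axis j 1) = (if i = j then axis j 1 else 0)))"

text \<open>A choice of signs of the square roots: \<open>h p $ i\<close> is \<open>\<eta>\<^bsub>ii\<^esub>\<^sup>-\<^sup>1\<^sup>/\<^sup>2\<close>, and \<open>f\<^sub>i = h\<^sub>i \<partial>/\<partial>u\<^sub>i\<close>.\<close>
definition normalizing_factors ::
    "('m, 'n::finite) frobenius_data \<Rightarrow> ('m, 'n) chart \<Rightarrow> ('m \<Rightarrow> complex^'n) \<Rightarrow> bool" where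
  "normalizing_factors F cu h \<longleftrightarrow>
     (\<forall>i. holo_chart cu (\<lambda>p. h p $ i) \<and>
       (\<forall>p\<in>fst cu. (h p $ i)\<^sup>2 * pairing F cu p (axis i 1) (axis i 1) = 1))"

text \<open>The matrix \<open>\<Psi>\<close> of the change of basis, \<open>\<partial>/\<partial>v\<^sup>\<alpha> = \<Sum>\<^sub>i \<Psi>\<^bsub>i\<alpha>\<^esub> f\<^sub>i\<close> with \<open>f\<^sub>i = h\<^sub>i \<partial>/\<partial>u\<^sub>i\<close>: it is
  inverse to the matrix whose \<open>i\<close>-th column consists of the components of \<open>f\<^sub>i\<close> in the coordinates \<open>v\<close>.\<close>
definition Psi :: "('m, 'n::finite) chart \<Rightarrow> ('m, 'n) chart \<Rightarrow> ('m \<Rightarrow> complex^'n)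
    \<Rightarrow> 'm \<Rightarrow> complex^'n^'n" where
  "Psi cv cu h p = matrix_inv (\<chi> \<beta> i. h p $ i * coord_field cu i cv p $ \<beta>)"

definition V_matrix :: "('m, 'n::finite) chart \<Rightarrow> ('m, 'n) chart \<Rightarrow> ('m \<Rightarrow> complex^'n)
    \<Rightarrow> complex^'n \<Rightarrow> 'm \<Rightarrow> complex^'n^'n" where
  "V_matrix cv cu h \<mu> p = Psi cv cu h p ** diag_matrix \<mu> ** matrix_inv (Psi cv cu h p)"


section \<open>Monodromy data at the origin and calibrations\<close>

text \<open>\<open>U_matrix\<close> is the matrix \<open>\<U>\<close> of multiplication by \<open>E\<close>.\<close>
definition U_matrix ::
    "('m, 'n::finite) frobenius_data \<Rightarrow> ('m, 'n) chart \<Rightarrow> 'm \<Rightarrow> complex^'n^'n" where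
  "U_matrix F c p = (\<chi> \<alpha> \<beta>. \<Sum>\<rho>\<in>UNIV. euler F c p $ \<rho> * sc F c p \<rho> $ \<alpha> $ \<beta>)"

text \<open>The branch of \<open>log z\<close> with \<open>arg z \<in> (\<phi> - \<pi>, \<phi> + \<pi>]\<close>.\<close>
definition log_branch :: "real \<Rightarrow> complex \<Rightarrow> complex" where
  "log_branch \<phi> z = Ln (z * cis (- \<phi>)) + \<i> * of_real \<phi>"

text \<open>The multivalued function \<open>\<Theta> z\<^sup>\<mu> z\<^sup>R\<close>, as a function of the value \<open>l\<close> of \<open>log z\<close>.\<close>
definition Y_origin :: "('m \<Rightarrow> complex \<Rightarrow> complex^'n^'n) \<Rightarrow> complex^'n::finite \<Rightarrow> complex^'n^'n
    \<Rightarrow> 'm \<Rightarrow> complex \<Rightarrow> complex^'n^'n" where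
  "Y_origin \<Theta> \<mu> R p l = \<Theta> p (exp l) ** diag_matrix (\<chi> a. exp (\<mu> $ a * l)) **
     matrix_exp (scale_matrix l R)"

definition monodromy_data :: "('m, 'n::finite) frobenius_data \<Rightarrow> ('m, 'n) chart
    \<Rightarrow> complex^'n^'n \<Rightarrow> complex^'n \<Rightarrow> complex^'n^'n \<Rightarrow> (nat \<Rightarrow> complex^'n^'n)
    \<Rightarrow> ('m \<Rightarrow> complex \<Rightarrow> complex^'n^'n) \<Rightarrow> bool" where
  "monodromy_data F c \<eta> \<mu> R Rs \<Theta> \<longleftrightarrow>
     Rs 0 = 0 \<and> finite {s. Rs s \<noteq> 0} \<and> R = (\<Sum>s | Rs s \<noteq> 0. Rs s) \<and>
     (\<forall>l. diag_matrix (\<chi> a. exp (\<mu> $ a * l)) ** R ** diag_matrix (\<chi> a. exp (- \<mu> $ a * l))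
        = (\<Sum>s | Rs s \<noteq> 0. scale_matrix (exp l ^ s) (Rs s))) \<and>
     (\<forall>s\<ge>1. matrix_inv \<eta> ** transpose (Rs s) ** \<eta> = scale_matrix ((-1) ^ (s + 1)) (Rs s)) \<and>
     (\<forall>\<alpha> \<beta>. \<forall>x \<in> snd c ` fst c. \<forall>z. \<exists>D.
        ((\<lambda>(y, w). \<Theta> (chart_inv c y) w $ \<alpha> $ \<beta>) has_derivative D) (at (x, z)) \<and>
        (\<forall>a y w. D (a *s y, a * w) = a * D (y, w))) \<and>
     (\<forall>p\<in>fst c. \<Theta> p 0 = mat 1) \<and>
     (\<forall>p\<in>fst c. \<forall>z. matrix_inv \<eta> ** transpose (\<Theta> p (- z)) ** \<eta> ** \<Theta> p z = mat 1) \<and>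
     (\<forall>p\<in>fst c. \<forall>l. invertible (Y_origin \<Theta> \<mu> R p l) \<and>
        (\<forall>\<alpha>. (\<chi> a b. pd c \<alpha> (\<lambda>q. Y_origin \<Theta> \<mu> R q l $ a $ b) p)
           = scale_matrix (exp l) (sc F c p \<alpha> ** Y_origin \<Theta> \<mu> R p l))) \<and>
     (\<forall>p\<in>fst c. \<forall>\<phi> z. z * cis (- \<phi>) \<notin> \<real>\<^sub>\<le>\<^sub>0 \<longrightarrow>
        (\<forall>a b. ((\<lambda>w. Y_origin \<Theta> \<mu> R p (log_branch \<phi> w) $ a $ b) has_field_derivative
           ((U_matrix F c p + scale_matrix (1 / z) (diag_matrix \<mu>)) **
              Y_origin \<Theta> \<mu> R p (log_branch \<phi> z)) $ a $ b) (at z)))"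

definition grad_pairing :: "('m, 'n::finite) frobenius_data \<Rightarrow> ('m, 'n) chart
    \<Rightarrow> ('m \<Rightarrow> complex) \<Rightarrow> ('m \<Rightarrow> complex) \<Rightarrow> 'm \<Rightarrow> complex" where
  "grad_pairing F c f g p =
     (\<Sum>a\<in>UNIV. \<Sum>b\<in>UNIV. matrix_inv (metric F c p) $ a $ b * pd c a f p * pd c b g p)"

text \<open>The coefficient of \<open>z\<^sup>m\<close> in \<open>\<Theta>\<close>, and its sum; the family \<open>\<theta> \<alpha> m\<close> stands for \<open>\<theta>\<^bsub>\<alpha>,m\<^esub>\<close>. The gradient
  of \<open>\<theta>\<^sub>\<alpha> = \<Sum>\<^sub>m \<theta>\<^bsub>\<alpha>,m\<^esub> z\<^sup>m\<close> is taken coefficientwise in \<open>z\<close>.\<close>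
definition Theta_coeff :: "('m, 'n::finite) frobenius_data \<Rightarrow> ('m, 'n) chart
    \<Rightarrow> ('n \<Rightarrow> nat \<Rightarrow> 'm \<Rightarrow> complex) \<Rightarrow> 'm \<Rightarrow> nat \<Rightarrow> complex^'n^'n" where
  "Theta_coeff F c \<theta> p m =
     (\<chi> \<alpha> \<beta>. \<Sum>\<gamma>\<in>UNIV. matrix_inv (metric F c p) $ \<alpha> $ \<gamma> * pd c \<gamma> (\<theta> \<beta> m) p)"

definition Theta_of :: "('m, 'n::finite) frobenius_data \<Rightarrow> ('m, 'n) chart
    \<Rightarrow> ('n \<Rightarrow> nat \<Rightarrow> 'm \<Rightarrow> complex) \<Rightarrow> 'm \<Rightarrow> complex \<Rightarrow> complex^'n^'n" where
  "Theta_of F c \<theta> p z = (\<chi> \<alpha> \<beta>. \<Sum>m. Theta_coeff F c \<theta> p m $ \<alpha> $ \<beta> * z ^ m)"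

text \<open>A calibration associated to monodromy data \<open>(\<mu>, R)\<close> with fundamental solution
  \<open>\<Theta> z\<^sup>\<mu> z\<^sup>R\<close>. Identities between power series in \<open>z\<close> are stated coefficientwise.\<close>
definition calibration :: "('m, 'n::finite) frobenius_data \<Rightarrow> ('m, 'n) chart
    \<Rightarrow> 'n \<Rightarrow> complex^'n^'n \<Rightarrow> complex^'n \<Rightarrow> (nat \<Rightarrow> complex^'n^'n)
    \<Rightarrow> ('m \<Rightarrow> complex \<Rightarrow> complex^'n^'n) \<Rightarrow> ('n \<Rightarrow> nat \<Rightarrow> 'm \<Rightarrow> complex) \<Rightarrow> bool" where
  "calibration F c \<iota> \<eta> \<mu> Rs \<Theta> \<theta> \<longleftrightarrow>
     (\<forall>\<alpha> m. holo_chart c (\<theta> \<alpha> m)) \<and>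
     (\<forall>p\<in>fst c. \<forall>\<alpha> \<beta> \<gamma> m.
        \<theta> \<alpha> 0 p = (\<Sum>\<rho>\<in>UNIV. \<eta> $ \<alpha> $ \<rho> * snd c p $ \<rho>) \<and>
        pd c \<alpha> (pd c \<beta> (\<theta> \<gamma> (Suc m))) p
          = (\<Sum>\<sigma>\<in>UNIV. sc F c p \<alpha> $ \<sigma> $ \<beta> * pd c \<sigma> (\<theta> \<gamma> m) p) \<and>
        (\<Sum>k\<le>m. (-1) ^ (m - k) * grad_pairing F c (\<theta> \<alpha> k) (\<theta> \<beta> (m - k)) p)
          = (if m = 0 then \<eta> $ \<alpha> $ \<beta> else 0) \<and>
        pd c \<iota> (\<theta> \<alpha> (Suc m)) p = \<theta> \<alpha> m p \<and>
        vector_derivative_along c (euler F c) (pd c \<beta> (\<theta> \<alpha> m)) p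
          = (of_nat m + \<mu> $ \<alpha> + \<mu> $ \<beta>) * pd c \<beta> (\<theta> \<alpha> m) p
            + (\<Sum>g\<in>UNIV. \<Sum>k=1..m. Rs k $ g $ \<alpha> * pd c \<beta> (\<theta> g (m - k)) p)) \<and>
     (\<forall>p\<in>fst c. \<forall>z \<alpha> \<beta>.
        (\<lambda>m. Theta_coeff F c \<theta> p m $ \<alpha> $ \<beta> * z ^ m) sums (\<Theta> p z $ \<alpha> $ \<beta>))"

text \<open>\<open>\<Omega> \<alpha> k \<beta> l\<close> is the coefficient of \<open>z\<^sup>k w\<^sup>l\<close> in \<open>(\<langle>\<nabla>\<theta>\<^sub>\<alpha>(z), \<nabla>\<theta>\<^sub>\<beta>(w)\<rangle> - \<eta>\<^bsub>\<alpha>\<beta>\<^esub>) / (z + w)\<close>; the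
  condition compares coefficients after multiplication by \<open>z + w\<close>.\<close>
definition two_point_functions :: "('m, 'n::finite) frobenius_data \<Rightarrow> ('m, 'n) chart
    \<Rightarrow> complex^'n^'n \<Rightarrow> ('n \<Rightarrow> nat \<Rightarrow> 'm \<Rightarrow> complex)
    \<Rightarrow> ('n \<Rightarrow> nat \<Rightarrow> 'n \<Rightarrow> nat \<Rightarrow> 'm \<Rightarrow> complex) \<Rightarrow> bool" where
  "two_point_functions F c \<eta> \<theta> \<Omega> \<longleftrightarrow>
     (\<forall>p\<in>fst c. \<forall>\<alpha> \<beta> k l.
        (if k = 0 then 0 else \<Omega> \<alpha> (k - 1) \<beta> l p) + (if l = 0 then 0 else \<Omega> \<alpha> k \<beta> (l - 1) p)
        = grad_pairing F c (\<theta> \<alpha> k) (\<theta> \<beta> l) p - (if k = 0 \<and> l = 0 then \<eta> $ \<alpha> $ \<beta> else 0))"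


section \<open>The transformed Frobenius manifold\<close>

text \<open>\<open>S_kappa F c \<kappa>\<close> lives on the domain of the flat chart \<open>c\<close> and differs from \<open>F\<close> only in the
  metric \<open>\<langle>x, y\<rangle>\<^sup>\<and> = \<langle>\<partial>/\<partial>v\<^sup>\<kappa> \<cdot> x, \<partial>/\<partial>v\<^sup>\<kappa> \<cdot> y\<rangle>\<close>.\<close>
definition S_kappa :: "('m, 'n::finite) frobenius_data \<Rightarrow> ('m, 'n) chart \<Rightarrow> 'n
    \<Rightarrow> ('m, 'n) frobenius_data" where
  "S_kappa F c \<kappa> =
     \<lparr>space_of = subtopology (space_of F) (fst c),
      charts = {d \<in> charts F. fst d \<subseteq> fst c},
      sc = sc F,
      unity = unity F,
      metric = (\<lambda>d p. \<chi> a b.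
        pairing F d p (mult F d p (coord_field c \<kappa> d p) (axis a 1))
                      (mult F d p (coord_field c \<kappa> d p) (axis b 1))),
      euler = euler F\<rparr>"

definition S_kappa_coordinates :: "complex^'n^'n \<Rightarrow> ('n \<Rightarrow> nat \<Rightarrow> 'n \<Rightarrow> nat \<Rightarrow> 'm \<Rightarrow> complex)
    \<Rightarrow> 'n::finite \<Rightarrow> 'm \<Rightarrow> complex^'n" where
  "S_kappa_coordinates \<eta> \<Omega> \<kappa> p = (\<chi> \<alpha>. \<Sum>\<beta>\<in>UNIV. matrix_inv \<eta> $ \<alpha> $ \<beta> * \<Omega> \<beta> 0 \<kappa> 0 p)"

definition S_kappa_calibration :: "('n \<Rightarrow> nat \<Rightarrow> 'n \<Rightarrow> nat \<Rightarrow> 'm \<Rightarrow> complex)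
    \<Rightarrow> 'n \<Rightarrow> 'n \<Rightarrow> nat \<Rightarrow> 'm \<Rightarrow> complex" where
  "S_kappa_calibration \<Omega> \<kappa> \<alpha> m = \<Omega> \<alpha> m \<kappa> 0"

text \<open>The orthonormal frame of \<open>S_kappa\<close> is \<open>\<psi>\<^bsub>i\<kappa>\<^esub>\<^sup>-\<^sup>1 \<partial>/\<partial>u\<^sub>i\<close>.\<close>
definition S_kappa_factors :: "('m, 'n::finite) chart \<Rightarrow> ('m, 'n) chart
    \<Rightarrow> ('m \<Rightarrow> complex^'n) \<Rightarrow> 'n \<Rightarrow> 'm \<Rightarrow> complex^'n" where
  "S_kappa_factors cv cu h \<kappa> p = (\<chi> i. inverse (Psi cv cu h p $ i $ \<kappa>))"


section \<open>Formal solutions at infinity, Stokes and central connection matrices\<close>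

text \<open>The pair \<open>(\<Phi>, u)\<close> stands for the formal expression
  \<open>(\<Sum>\<^sub>k \<Phi>\<^sub>k z\<^sup>-\<^sup>k) e\<^sup>z\<^sup>U\<close> with \<open>U = diag u\<close>.\<close>
type_synonym 'n formal_matrix = "(nat \<Rightarrow> complex^'n^'n) \<times> (complex^'n)"

text \<open>The equations are obtained by substituting \<open>Y = \<Phi> e\<^sup>z\<^sup>U\<close>, cancelling \<open>e\<^sup>z\<^sup>U\<close> on the right and
  comparing coefficients of powers of \<open>z\<close>; the first pair of equations comes from
  \<open>\<Phi>' + \<Phi> U = (U + V/z) \<Phi>\<close>, the second one from \<open>\<partial>\<^sub>i\<Phi> + z \<Phi> E\<^sub>i = (z E\<^sub>i + V\<^sub>i) \<Phi>\<close>.\<close>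
definition normalized_formal_solution :: "('m, 'n::finite) chart \<Rightarrow> ('m, 'n) chart
    \<Rightarrow> ('m \<Rightarrow> complex^'n) \<Rightarrow> complex^'n \<Rightarrow> ('m \<Rightarrow> 'n formal_matrix) \<Rightarrow> bool" where
  "normalized_formal_solution cv cu h \<mu> Y \<longleftrightarrow>
     (\<forall>k a b. holo_chart cu (\<lambda>p. fst (Y p) k $ a $ b)) \<and>
     (\<forall>p\<in>fst cu.
        let u = snd cu p; U = diag_matrix u; V = V_matrix cv cu h \<mu> p; \<Phi> = fst (Y p) in
        snd (Y p) = u \<and> \<Phi> 0 = mat 1 \<and>
        \<Phi> 0 ** U = U ** \<Phi> 0 \<and>
        (\<forall>k. \<Phi> (Suc k) ** U - scale_matrix (of_nat k) (\<Phi> k) = U ** \<Phi> (Suc k) + V ** \<Phi> k) \<and>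
        (\<forall>i. \<Phi> 0 ** unit_matrix i = unit_matrix i ** \<Phi> 0) \<and>
        (\<forall>i k. (\<chi> a b. pd cu i (\<lambda>q. fst (Y q) k $ a $ b) p) + \<Phi> (Suc k) ** unit_matrix i
           = unit_matrix i ** \<Phi> (Suc k)
             + ad_inv u (unit_matrix i ** V - V ** unit_matrix i) ** \<Phi> k) \<and>
        (\<forall>k. (\<Sum>j\<le>k. scale_matrix ((-1) ^ j) (transpose (\<Phi> j) ** \<Phi> (k - j)))
           = (if k = 0 then mat 1 else 0)))"

definition open_sector :: "real \<Rightarrow> real \<Rightarrow> complex set" where
  "open_sector a b = {of_real r * cis t | r t. 0 < r \<and> a < t \<and> t < b}"

definition closed_sector :: "real \<Rightarrow> real \<Rightarrow> complex set" where
  "closed_sector a b = {of_real r * cis t | r t. 0 < r \<and> a \<le> t \<and> t \<le> b}"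

text \<open>The line through the origin with positive ray \<open>arg z = \<phi>\<close>, and its admissibility.\<close>
definition line_at :: "real \<Rightarrow> complex set" where
  "line_at \<phi> = {of_real r * cis \<phi> | r. True}"

definition admissible :: "real \<Rightarrow> complex^'n \<Rightarrow> bool" where
  "admissible \<phi> u \<longleftrightarrow> (\<forall>z \<in> line_at \<phi> - {0}. \<forall>i j. i \<noteq> j \<longrightarrow> Re (z * (u $ i - u $ j)) \<noteq> 0)"

text \<open>\<open>W\<close> is asymptotic to the formal expression \<open>Y\<close> as \<open>|z| \<rightarrow> \<infinity>\<close> in the sector (uniformly on
  closed subsectors, in the sense of Poincare).\<close>
definition asymptotic_in_sector ::
    "real \<Rightarrow> real \<Rightarrow> (complex \<Rightarrow> complex^'n^'n) \<Rightarrow> 'n::finite formal_matrix \<Rightarrow> bool" where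
  "asymptotic_in_sector a b W Y \<longleftrightarrow>
     (\<forall>a' b' N i j. a < a' \<and> a' \<le> b' \<and> b' < b \<longrightarrow>
        (\<lambda>z. (W z ** diag_matrix (\<chi> i. exp (- z * snd Y $ i))
               - (\<Sum>k<N. scale_matrix (1 / z ^ k) (fst Y k))) $ i $ j)
        \<in> O[inf at_infinity (principal (closed_sector a' b'))](\<lambda>z. 1 / z ^ N))"

text \<open>Fundamental solutions of \<open>dY/dz = (U + V/z) Y\<close> on a sector with prescribed asymptotics.\<close>
definition sectorial_solution :: "complex^'n^'n \<Rightarrow> 'n::finite formal_matrix \<Rightarrow> real \<Rightarrow> real
    \<Rightarrow> (complex \<Rightarrow> complex^'n^'n) \<Rightarrow> bool" where
  "sectorial_solution V Y a b W \<longleftrightarrow>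
     (\<forall>z \<in> open_sector a b. invertible (W z) \<and>
        (\<forall>i j. ((\<lambda>w. W w $ i $ j) has_field_derivative
           ((diag_matrix (snd Y) + scale_matrix (1 / z) V) ** W z) $ i $ j) (at z))) \<and>
     asymptotic_in_sector a b W Y"

text \<open>\<open>\<epsilon>\<close> is small: rotating the line by less than \<open>\<epsilon>\<close> keeps it admissible.\<close>
definition small_angle :: "real \<Rightarrow> complex^'n \<Rightarrow> real \<Rightarrow> bool" where
  "small_angle \<phi> u \<epsilon> \<longleftrightarrow> 0 < \<epsilon> \<and> \<epsilon> < pi / 2 \<and> (\<forall>t. \<bar>t - \<phi>\<bar> < \<epsilon> \<longrightarrow> admissible t u)"

text \<open>\<open>Y\<close> is the normalized formal solution. The Stokes and central connection matrices are
  constant, i.e. the same matrix serves at all points.\<close>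
definition stokes_matrix :: "('m, 'n::finite) chart \<Rightarrow> ('m, 'n) chart
    \<Rightarrow> ('m \<Rightarrow> complex^'n) \<Rightarrow> complex^'n \<Rightarrow> ('m \<Rightarrow> 'n formal_matrix) \<Rightarrow> real
    \<Rightarrow> complex^'n^'n \<Rightarrow> bool" where
  "stokes_matrix cv cu h \<mu> Y \<phi> S \<longleftrightarrow>
     (\<forall>p\<in>fst cu. \<exists>\<epsilon> Yright Yleft. small_angle \<phi> (snd cu p) \<epsilon> \<and>
        sectorial_solution (V_matrix cv cu h \<mu> p) (Y p) (\<phi> - pi - \<epsilon>) (\<phi> + \<epsilon>) Yright \<and>
        sectorial_solution (V_matrix cv cu h \<mu> p) (Y p) (\<phi> - \<epsilon>) (\<phi> + pi + \<epsilon>) Yleft \<and>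
        (\<forall>z \<in> open_sector (\<phi> - \<epsilon>) (\<phi> + \<epsilon>). Yleft z = Yright z ** S))"

definition central_connection_matrix :: "('m, 'n::finite) frobenius_data \<Rightarrow> ('m, 'n) chart
    \<Rightarrow> ('m, 'n) chart \<Rightarrow> ('m \<Rightarrow> complex^'n) \<Rightarrow> complex^'n \<Rightarrow> complex^'n^'n
    \<Rightarrow> ('n \<Rightarrow> nat \<Rightarrow> 'm \<Rightarrow> complex) \<Rightarrow> ('m \<Rightarrow> 'n formal_matrix) \<Rightarrow> real
    \<Rightarrow> complex^'n^'n \<Rightarrow> bool" where
  "central_connection_matrix F cv cu h \<mu> R \<theta> Y \<phi> C \<longleftrightarrow>
     (\<forall>p\<in>fst cu. \<exists>\<epsilon> Yright. small_angle \<phi> (snd cu p) \<epsilon> \<and>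
        sectorial_solution (V_matrix cv cu h \<mu> p) (Y p) (\<phi> - pi - \<epsilon>) (\<phi> + \<epsilon>) Yright \<and>
        (\<forall>z \<in> open_sector (\<phi> - \<epsilon>) (\<phi> + \<epsilon>).
           Yright z = Psi cv cu h p **
             Y_origin (Theta_of F cv \<theta>) \<mu> R p (log_branch \<phi> z) ** C))"

end

theory Submission
  imports Defs "HOL-Complex_Analysis.Cauchy_Integral_Formula"
begin

text \<open>
  The two-point function \<open>\<Omega>\<^bsub>\<alpha>,m;\<kappa>,0\<^esub>\<close> equals \<open>\<partial>\<theta>\<^bsub>\<alpha>,m+1\<^esub>/\<partial>v\<^sup>\<kappa>\<close>, so its differential is that of
  \<open>\<theta>\<^bsub>\<alpha>,m\<^esub>\<close> composed with the multiplication \<open>c\<^sub>\<kappa>\<close> by \<open>\<partial>/\<partial>v\<^sup>\<kappa>\<close>. Hence \<open>c\<^sub>\<kappa>\<close> is the Jacobian of the new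
  flat coordinates with respect to the old ones. As \<open>c\<^sub>\<kappa>\<close> is diagonal in canonical coordinates, with
  eigenvalues \<open>\<psi>\<^bsub>i\<kappa>\<^esub> \<eta>\<^bsub>ii\<^esub>\<^sup>-\<^sup>1\<^sup>/\<^sup>2\<close>, the rescaling of the frame compensates it exactly: \<open>\<Psi>\<close>, and therefore \<open>V\<close>,
  is the same for both manifolds, and so is \<open>\<Theta>\<close>. Both manifolds then define the same linear system
  with the same solution at the origin, and it remains to see that the normalized formal solution
  and the sectorial solutions are unique.
\<close>

section \<open>Mixed partial derivatives of holomorphic functions\<close>

text \<open>Taylor's formula of order one. For \<open>x\<close> in \<open>ball 0 (r / 2)\<close> the
  disc of radius \<open>r / 2\<close> about \<open>x\<close> lies in the large disc, so Cauchy's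
  inequality bounds the second derivative by \<open>2 * B / (r / 2)\<^sup>2\<close>, which is the
  constant here. The bound sees \<open>f\<close> only through \<open>B\<close>, hence is uniform
  over families with a common bound.\<close>

lemma difference_quotient_bound:
  assumes holf: "f holomorphic_on ball 0 r" and contf: "continuous_on (cball 0 r) f"
    and bound: "\<And>x. x \<in> cball 0 r \<Longrightarrow> norm (f x) \<le> B"
    and r: "0 < r" and h: "norm h < r / 2" "h \<noteq> 0"
  shows "norm ((f h - f 0) / h - deriv f 0) \<le> 8 * B / r\<^sup>2 * norm (h :: complex)"
proof -
  have second: "norm ((deriv ^^ Suc 1) f x) \<le> 8 * B / r\<^sup>2" if "x \<in> ball 0 (r / 2)" for x
  proof -
    have sub: "cball x (r / 2) \<subseteq> cball 0 r" "ball x (r / 2) \<subseteq> ball 0 r"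
      using that by (auto simp: cball_subset_cball_iff ball_subset_ball_iff)
    have "norm ((deriv ^^ 2) f x) \<le> fact 2 * B / (r / 2) ^ 2"
    proof (rule Cauchy_inequality)
      show "norm (f y) \<le> B" if "norm (x - y) = r / 2" for y
        using sub that by (intro bound) (auto simp: dist_norm)
    qed (use sub holf contf r in \<open>auto intro: holomorphic_on_subset continuous_on_subset\<close>)
    also have "\<dots> = 8 * B / r\<^sup>2"
      by (simp add: power_divide)
    finally show ?thesis
      by (simp add: numeral_2_eq_2)
  qed
  have derivs: "((deriv ^^ i) f has_field_derivative (deriv ^^ Suc i) f x) (at x within ball 0 (r / 2))"
    if "x \<in> ball 0 (r / 2)" for i x
  proof -
    have "(deriv ^^ i) f holomorphic_on ball 0 r"
      by (rule holomorphic_higher_deriv[OF holf open_ball])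
    moreover have "x \<in> ball 0 r"
      using that r by auto
    ultimately show ?thesis
      by (metis DERIV_deriv_iff_field_differentiable comp_apply funpow.simps(2)
          has_field_derivative_at_within holomorphic_on_imp_differentiable_at open_ball)
  qed
  have "norm ((deriv ^^ 0) f h - (\<Sum>i\<le>1. (deriv ^^ i) f 0 * (h - 0) ^ i / fact i))
      \<le> 8 * B / r\<^sup>2 * norm (h - 0) ^ Suc 1 / fact 1"
    by (rule complex_Taylor[where S = "ball 0 (r / 2)"]) (use derivs second r h in auto)
  then have est: "norm (f h - f 0 - deriv f 0 * h) \<le> 8 * B / r\<^sup>2 * norm h ^ 2"
    by (simp add: power2_eq_square algebra_simps)
  have "norm ((f h - f 0) / h - deriv f 0) = norm (f h - f 0 - deriv f 0 * h) / norm h"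
  proof -
    have "(f h - f 0) / h - deriv f 0 = (f h - f 0 - deriv f 0 * h) / h"
      using h by (simp add: divide_simps)
    then show ?thesis
      by (simp add: norm_divide)
  qed
  also have "\<dots> \<le> 8 * B / r\<^sup>2 * norm h ^ 2 / norm h"
    by (intro divide_right_mono est) simp
  also have "\<dots> = 8 * B / r\<^sup>2 * norm h"
    using h by (simp add: power2_eq_square)
  finally show ?thesis .
qed

text \<open>The difference quotients in \<open>z\<close> converge uniformly in \<open>t\<close>, so their \<open>t\<close>-derivatives converge too;
  no differentiability of the partial derivatives has to be assumed.\<close>
lemma mixed_derivative:
  fixes F :: "complex \<Rightarrow> complex \<Rightarrow> complex"
  assumes r: "0 < r"
    and cont: "continuous_on (cball 0 r \<times> cball 0 r) (\<lambda>(t, z). F t z)"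
    and holt: "\<And>z. z \<in> ball 0 r \<Longrightarrow> (\<lambda>t. F t z) holomorphic_on ball 0 r"
    and holz: "\<And>t. t \<in> ball 0 r \<Longrightarrow> F t holomorphic_on ball 0 r"
  obtains D where "((\<lambda>t. deriv (F t) 0) has_field_derivative D) (at 0)"
    and "((\<lambda>z. deriv (\<lambda>t. F t z) 0) has_field_derivative D) (at 0)"
proof -
  have "compact ((\<lambda>(t, z). F t z) ` (cball 0 r \<times> cball 0 r))"
    by (intro compact_continuous_image cont compact_Times compact_cball)
  then have "\<exists>B. \<forall>t\<in>cball 0 r. \<forall>z\<in>cball 0 r. norm (F t z) \<le> B"
    by (auto dest!: compact_imp_bounded simp: bounded_iff)
  then obtain B where B: "norm (F t z) \<le> B" if "t \<in> cball 0 r" "z \<in> cball 0 r" for t z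
    by blast
  have contz: "continuous_on (cball 0 r) (F t)" if "t \<in> cball 0 r" for t
  proof -
    have "continuous_on (cball 0 r) (\<lambda>z. (t, z))"
      by (intro continuous_on_Pair continuous_on_const continuous_on_id)
    then show ?thesis
      using continuous_on_compose2[OF cont, of "cball 0 r" "\<lambda>z. (t, z)"] that
      by (simp add: image_subset_iff)
  qed
  have diff: "(\<lambda>t. F t z) field_differentiable at t" if "t \<in> ball 0 r" "z \<in> ball 0 r" for t z
    using holt that holomorphic_on_imp_differentiable_at by blast
  define f where "f h t = (F t h - F t 0) / h" for h t
  define f' where "f' h t = (deriv (\<lambda>t. F t h) t - deriv (\<lambda>t. F t 0) t) / h" for h t
  have small: "\<forall>\<^sub>F h in at 0. norm h < r / 2 \<and> h \<noteq> (0 :: complex)"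
    using r by (auto simp: eventually_at dist_norm intro!: exI[of _ "r / 2"])
  have "\<forall>\<^sub>F h in at 0. continuous_on (cball 0 (r / 2)) (f h) \<and>
      (\<forall>t \<in> ball 0 (r / 2). (f h has_field_derivative f' h t) (at t))"
    using small
  proof eventually_elim
    case (elim h)
    then have h: "h \<in> ball 0 r" "h \<noteq> 0"
      using r by auto
    have D: "(f h has_field_derivative f' h t) (at t)" if "t \<in> ball 0 r" for t
      unfolding f_def f'_def using h that r
      by (auto intro!: derivative_eq_intros DERIV_deriv_iff_field_differentiable[THEN iffD2] diff)
    moreover have "continuous_on (cball 0 (r / 2)) (f h)"
      using r by (intro continuous_at_imp_continuous_on ballI) (rule DERIV_isCont[OF D], auto)
    ultimately show ?case
      using r by auto
  qed
  moreover have "uniform_limit (cball 0 (r / 2)) f (\<lambda>t. deriv (F t) 0) (at 0)"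
  proof (rule uniform_limitI)
    fix e :: real
    assume e: "0 < e"
    have "((\<lambda>h::complex. 8 * B / r\<^sup>2 * norm h) \<longlongrightarrow> 8 * B / r\<^sup>2 * norm (0::complex)) (at 0)"
      by (intro tendsto_intros)
    then have "\<forall>\<^sub>F h in at (0::complex). 8 * B / r\<^sup>2 * norm h < e"
      using e by (simp add: order_tendstoD)
    then show "\<forall>\<^sub>F h in at 0. \<forall>t \<in> cball 0 (r / 2). dist (f h t) (deriv (F t) 0) < e"
      using small
    proof eventually_elim
      case (elim h)
      show ?case
      proof
        fix t :: complex
        assume "t \<in> cball 0 (r / 2)"
        then have t: "t \<in> ball 0 r" "t \<in> cball 0 r"
          using r by auto
        have "norm (f h t - deriv (F t) 0) \<le> 8 * B / r\<^sup>2 * norm h"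
          unfolding f_def
          by (rule difference_quotient_bound) (use t B contz holz r elim in auto)
        then show "dist (f h t) (deriv (F t) 0) < e"
          using elim by (simp add: dist_norm)
      qed
    qed
  qed
  ultimately obtain g' where g':
    "\<And>t. t \<in> ball 0 (r / 2) \<Longrightarrow>
      ((\<lambda>t. deriv (F t) 0) has_field_derivative g' t) (at t) \<and> ((\<lambda>h. f' h t) \<longlongrightarrow> g' t) (at 0)"
    by (rule has_complex_derivative_uniform_limit) (use r in auto)
  \<comment> \<open>Read as a function of \<open>h\<close>, \<open>f' h 0\<close> is the difference
    quotient in \<open>z\<close> of the \<open>t\<close>-derivative, so its limit
    \<open>g' 0\<close> is also the other mixed derivative.\<close>
  have "((\<lambda>z. deriv (\<lambda>t. F t z) 0) has_field_derivative g' 0) (at 0)"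
    using g'[of 0] r by (simp add: has_field_derivative_iff f'_def)
  then show ?thesis
    using g'[of 0] r that by auto
qed

section \<open>Chain rules for holomorphic functions of several variables\<close>

lemma has_field_derivative_axis:
  "((\<lambda>z. (y + axis k z) $ j) has_field_derivative (if j = k then 1 else 0)) (at a)"
  by (auto simp: axis_def intro!: derivative_eq_intros)

text \<open>The total derivative provided by \<open>holo_on\<close> is complex linear, so along a
  curve it yields a complex derivative. Partial derivatives are written as \<open>deriv\<close>
  along \<open>axis k z\<close>, the form to which \<open>pd\<close> unfolds.\<close>

lemma holo_on_chain:
  assumes f: "holo_on f S" and S: "x t \<in> S"
    and x: "\<And>k. ((\<lambda>s. x s $ k) has_field_derivative x' k) (at t)"
  shows "((\<lambda>s. f (x s)) has_field_derivative
     (\<Sum>k\<in>UNIV. x' k * deriv (\<lambda>z. f (x t + axis k z)) 0)) (at t)"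
proof -
  obtain D where D: "(f has_derivative D) (at (x t))" "\<And>a h. D (a *s h) = a * D h"
    using f S unfolding holo_on_def by blast
  interpret linear D
    using D(1) has_derivative_linear by blast
  \<comment> \<open>Needed for every curve through \<open>x t\<close>: the coordinate lines identify
    \<open>D (axis k 1)\<close> as a partial derivative, and the curve \<open>x\<close> then gives
    the claim.\<close>
  have gen: "((\<lambda>s. f (y s)) has_field_derivative D (\<chi> k. y' k)) (at a)"
    if y: "\<And>k. ((\<lambda>s. y s $ k) has_field_derivative y' k) (at a)" and ya: "y a = x t" for y y' a
  proof -
    have "(y has_derivative (\<lambda>h. h *s (\<chi> k. y' k))) (at a)"
      unfolding has_derivative_componentwise_within[of y]
    proof
      fix i :: "complex^'a"
      assume "i \<in> Basis"
      then obtain k b where i: "i = axis k b" "b \<in> Basis"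
        by (auto simp: Basis_vec_def)
      have "((\<lambda>s. y s $ k \<bullet> b) has_derivative (\<lambda>h. (y' k * h) \<bullet> b)) (at a)"
        by (intro has_derivative_inner_left y[unfolded has_field_derivative_def])
      then show "((\<lambda>s. y s \<bullet> i) has_derivative (\<lambda>h. (h *s (\<chi> k. y' k)) \<bullet> i)) (at a)"
        by (simp add: i inner_axis mult.commute)
    qed
    from diff_chain_at[OF this, of f D] show ?thesis
      using D ya by (simp add: has_field_derivative_def o_def mult_commute_abs)
  qed
  have "deriv (\<lambda>z. f (x t + axis k z)) 0 = D (axis k 1)" for k
  proof -
    have "((\<lambda>z. f (x t + axis k z)) has_field_derivative D (\<chi> j. if j = k then 1 else 0)) (at 0)"
      by (rule gen, rule has_field_derivative_axis) (simp add: axis_eq_0_iff)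
    then show ?thesis
      by (simp add: DERIV_imp_deriv axis_def)
  qed
  moreover have "D (\<chi> k. x' k) = (\<Sum>k\<in>UNIV. x' k * D (axis k 1))"
  proof -
    have "(\<chi> k. x' k) = (\<Sum>k\<in>UNIV. x' k *s axis k 1)"
      by (subst basis_expansion[symmetric, of "\<chi> k. x' k"]) simp
    then show ?thesis
      by (simp add: sum D(2))
  qed
  ultimately show ?thesis
    using gen[OF x] by simp
qed

text \<open>Supplies the bidisc required by \<open>mixed_derivative\<close>: the map in question is
  jointly continuous, so the preimage of \<open>S\<close> is an open neighbourhood of the
  origin.\<close>

lemma open_product_nbhd:
  fixes y :: "complex \<Rightarrow> complex^'n::finite"
  assumes y: "\<And>k. (\<lambda>t. y t $ k) holomorphic_on U" and U: "open U" "0 \<in> U"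
    and S: "open S" "y 0 \<in> S"
  obtains r where "0 < r" "cball 0 r \<subseteq> U"
    "\<And>t z. t \<in> cball 0 r \<Longrightarrow> z \<in> cball 0 r \<Longrightarrow> y t + axis l z \<in> S"
    "continuous_on (cball 0 r \<times> cball 0 r) (\<lambda>(t, z). y t + axis l z)"
proof -
  let ?g = "\<lambda>(t, z). y t + axis l z"
  have "continuous_on U (\<lambda>t. \<chi> k. y t $ k)"
    by (intro continuous_intros holomorphic_on_imp_continuous_on y)
  then have cy: "continuous_on U y"
    by simp
  have axis_eq: "axis l z = (\<chi> i. if i = l then z else 0)" for z :: complex
    by (simp add: axis_def)
  have cax: "continuous_on A (\<lambda>q. if i = l then g q else (0 :: complex))"
    if "continuous_on A g" for g :: "complex \<times> complex \<Rightarrow> complex" and A i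
    using that by (cases "i = l") auto
  have cg: "continuous_on (U \<times> UNIV) ?g"
    unfolding case_prod_beta axis_eq
    by (intro continuous_intros cax continuous_on_compose2[OF cy]) auto
  then have "open (U \<times> UNIV \<inter> ?g -` S)"
    using U S by (intro continuous_open_preimage open_Times) auto
  moreover have "(0, 0) \<in> U \<times> UNIV \<inter> ?g -` S"
    using U S by (simp add: axis_eq zero_vec_def[symmetric])
  ultimately obtain e where e: "0 < e" "cball (0, 0) e \<subseteq> U \<times> UNIV \<inter> ?g -` S"
    using open_contains_cball by blast
  \<comment> \<open>The radius is halved because the norm of a pair is at most the sum of the
    norms.\<close>
  have in_ball: "(t, z) \<in> U \<times> UNIV \<inter> ?g -` S" if "t \<in> cball 0 (e / 2)" "z \<in> cball 0 (e / 2)" for t z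
  proof -
    have "norm (t, z) \<le> e"
      using norm_Pair_le[of t z] that by simp
    then show ?thesis
      using e by (auto simp: dist_norm norm_minus_commute zero_prod_def[symmetric])
  qed
  show ?thesis
  proof
    show "cball 0 (e / 2) \<subseteq> U"
      using in_ball[of _ 0] e by auto
    then show "continuous_on (cball 0 (e / 2) \<times> cball 0 (e / 2)) ?g"
      by (intro continuous_on_subset[OF cg]) auto
  qed (use in_ball e in auto)
qed

text \<open>This is \<open>mixed_derivative\<close> for \<open>f (x t + axis l z)\<close>, with the
  inner \<open>t\<close>-derivative expanded by \<open>holo_on_chain\<close>.\<close>

lemma holo_on_mixed_derivative:
  fixes x :: "complex \<Rightarrow> complex^'n::finite"
  assumes f: "holo_on f S" and S: "open S" "x 0 \<in> S"
    and U: "open U" "0 \<in> U" and x: "\<And>k. (\<lambda>t. x t $ k) holomorphic_on U"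
  obtains D where
    "((\<lambda>t. deriv (\<lambda>z. f (x t + axis l z)) 0) has_field_derivative D) (at 0)"
    "((\<lambda>z. \<Sum>k\<in>UNIV. deriv (\<lambda>t. x t $ k) 0 * deriv (\<lambda>w. f (x 0 + axis l z + axis k w)) 0)
       has_field_derivative D) (at 0)"
proof -
  obtain r where r: "0 < r" "cball 0 r \<subseteq> U"
    "\<And>t z. t \<in> cball 0 r \<Longrightarrow> z \<in> cball 0 r \<Longrightarrow> x t + axis l z \<in> S"
    "continuous_on (cball 0 r \<times> cball 0 r) (\<lambda>(t, z). x t + axis l z)"
    by (rule open_product_nbhd[OF x U S]) blast
  define F where "F t z = f (x t + axis l z)" for t z
  have dx: "((\<lambda>s. (x s + axis l z) $ k) has_field_derivative deriv (\<lambda>t. x t $ k) t) (at t)"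
    if "t \<in> ball 0 r" for t z k
  proof -
    have "t \<in> U"
      using that r(2) by auto
    then have "((\<lambda>s. x s $ k) has_field_derivative deriv (\<lambda>t. x t $ k) t) (at t)"
      by (intro holomorphic_derivI[OF x U(1)])
    then show ?thesis
      by (auto intro!: derivative_eq_intros)
  qed
  have dF: "((\<lambda>s. F s z) has_field_derivative
      (\<Sum>k\<in>UNIV. deriv (\<lambda>t. x t $ k) t * deriv (\<lambda>w. f (x t + axis l z + axis k w)) 0)) (at t)"
    if "t \<in> ball 0 r" "z \<in> ball 0 r" for t z
    unfolding F_def
    by (rule holo_on_chain[where x = "\<lambda>s. x s + axis l z", OF f r(3) dx]) (use that in auto)
  have cf: "continuous_on S f"
    using f unfolding holo_on_def
    by (intro continuous_at_imp_continuous_on ballI) (blast intro: has_derivative_continuous)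
  have "(\<lambda>(t, z). x t + axis l z) ` (cball 0 r \<times> cball 0 r) \<subseteq> S"
    using r(3) by auto
  then have "continuous_on (cball 0 r \<times> cball 0 r) (\<lambda>(t, z). F t z)"
    using continuous_on_compose2[OF cf r(4)] unfolding F_def case_prod_beta by blast
  then obtain D where D: "((\<lambda>t. deriv (F t) 0) has_field_derivative D) (at 0)"
    "((\<lambda>z. deriv (\<lambda>t. F t z) 0) has_field_derivative D) (at 0)"
  proof (rule mixed_derivative[OF r(1)])
    show "(\<lambda>t. F t z) holomorphic_on ball 0 r" if "z \<in> ball 0 r" for z
      unfolding holomorphic_on_open[OF open_ball] using dF that by blast
    show "F t holomorphic_on ball 0 r" if "t \<in> ball 0 r" for t
    proof -
      have dFz: "(F t has_field_derivative
          (\<Sum>k\<in>UNIV. (if k = l then 1 else 0) * deriv (\<lambda>w. f (x t + axis l z + axis k w)) 0)) (at z)"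
        if "z \<in> ball 0 r" for z
        unfolding F_def
        by (rule holo_on_chain[where x = "\<lambda>s. x t + axis l s", OF f r(3) has_field_derivative_axis])
          (use that \<open>t \<in> ball 0 r\<close> in auto)
      show ?thesis
        unfolding holomorphic_on_open[OF open_ball] by (intro ballI exI) (rule dFz)
    qed
  qed blast
  have "\<forall>\<^sub>F z in nhds 0. deriv (\<lambda>t. F t z) 0 =
      (\<Sum>k\<in>UNIV. deriv (\<lambda>t. x t $ k) 0 * deriv (\<lambda>w. f (x 0 + axis l z + axis k w)) 0)"
    using eventually_nhds_ball[OF r(1), of 0]
  proof eventually_elim
    case (elim z)
    then show ?case
      using dF[of 0 z] r(1) by (intro DERIV_imp_deriv) auto
  qed
  from DERIV_cong_ev[OF refl this refl] D(2) have
    "((\<lambda>z. \<Sum>k\<in>UNIV. deriv (\<lambda>t. x t $ k) 0 * deriv (\<lambda>w. f (x 0 + axis l z + axis k w)) 0)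
       has_field_derivative D) (at 0)"
    by (rule iffD1)
  then show ?thesis
    using D(1) unfolding F_def by (rule that[rotated])
qed

text \<open>A chain rule for a partial derivative of \<open>f\<close>, although only
  \<open>f\<close> itself is assumed holomorphic. The previous lemma is used twice: along
  \<open>x\<close>, which moves the \<open>t\<close>-derivative inside, and along coordinate lines,
  which makes second partial derivatives symmetric.\<close>

lemma holo_on_partial_chain:
  fixes x :: "complex \<Rightarrow> complex^'n::finite"
  assumes f: "holo_on f S" and S: "open S" "x 0 \<in> S"
    and U: "open U" "0 \<in> U" and x: "\<And>k. (\<lambda>t. x t $ k) holomorphic_on U"
  shows "((\<lambda>t. deriv (\<lambda>z. f (x t + axis l z)) 0) has_field_derivative
     (\<Sum>k\<in>UNIV. deriv (\<lambda>t. x t $ k) 0 *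
        deriv (\<lambda>z. deriv (\<lambda>w. f (x 0 + axis k z + axis l w)) 0) 0)) (at 0)"
proof -
  \<comment> \<open>The curve is now the \<open>k\<close>-th coordinate line, whose velocity leaves
    a single term of the sum.\<close>
  have swap: "((\<lambda>z. deriv (\<lambda>w. f (x 0 + axis l z + axis k w)) 0) has_field_derivative
      deriv (\<lambda>z. deriv (\<lambda>w. f (x 0 + axis k z + axis l w)) 0) 0) (at 0)" for k
  proof -
    have hol: "(\<lambda>t. (x 0 + axis k t) $ j) holomorphic_on UNIV" for j
      using has_field_derivative_axis[of "x 0" k j] by (auto simp: holomorphic_on_open simp del: vector_add_component)
    have d: "deriv (\<lambda>t. (x 0 + axis k t) $ j) 0 = (if j = k then 1 else 0)" for j
      by (rule DERIV_imp_deriv[OF has_field_derivative_axis])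
    have x0: "x 0 + axis k 0 = x 0"
      by (simp add: axis_def vec_eq_iff)
    have S0: "x 0 + axis k 0 \<in> S"
      unfolding x0 by (rule S(2))
    show ?thesis
    proof (rule holo_on_mixed_derivative[OF f S(1) S0 open_UNIV UNIV_I hol, of l])
      fix D
      assume D: "((\<lambda>t. deriv (\<lambda>z. f (x 0 + axis k t + axis l z)) 0) has_field_derivative D) (at 0)"
        "((\<lambda>z. \<Sum>j\<in>UNIV. deriv (\<lambda>t. (x 0 + axis k t) $ j) 0 *
           deriv (\<lambda>w. f (x 0 + axis k 0 + axis l z + axis j w)) 0) has_field_derivative D) (at 0)"
      then show ?thesis
        unfolding d x0 by (simp add: DERIV_imp_deriv if_distrib[where f = "\<lambda>a. a * _"] cong: if_cong)
    qed
  qed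
  obtain D where D:
    "((\<lambda>t. deriv (\<lambda>z. f (x t + axis l z)) 0) has_field_derivative D) (at 0)"
    "((\<lambda>z. \<Sum>k\<in>UNIV. deriv (\<lambda>t. x t $ k) 0 * deriv (\<lambda>w. f (x 0 + axis l z + axis k w)) 0)
       has_field_derivative D) (at 0)"
    by (rule holo_on_mixed_derivative[OF f S U x]) blast
  have "((\<lambda>z. \<Sum>k\<in>UNIV. deriv (\<lambda>t. x t $ k) 0 * deriv (\<lambda>w. f (x 0 + axis l z + axis k w)) 0)
      has_field_derivative
      (\<Sum>k\<in>UNIV. deriv (\<lambda>t. x t $ k) 0 *
        deriv (\<lambda>z. deriv (\<lambda>w. f (x 0 + axis k z + axis l w)) 0) 0)) (at 0)"
    by (auto intro!: derivative_eq_intros swap simp: mult.commute)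
  from DERIV_unique[OF D(2) this] D(1) show ?thesis
    by simp
qed


section \<open>The flat coordinates, frame and calibration of the transformed manifold\<close>

lemma chart_inv_left:
  assumes "is_chart X c" "p \<in> fst c"
  shows "chart_inv c (snd c p) = p"
proof -
  have "topspace (subtopology X (fst c)) = fst c"
    using assms(1) openin_subset unfolding is_chart_def by (auto simp: topspace_subtopology)
  then have "inj_on (snd c) (fst c)"
    using assms(1) homeomorphic_imp_injective_map unfolding is_chart_def by metis
  then show ?thesis
    using assms(2) by (simp add: chart_inv_def)
qed

lemma chart_inv_right:
  assumes "y \<in> snd c ` fst c"
  shows "snd c (chart_inv c y) = y" "chart_inv c y \<in> fst c"
  using assms by (simp_all add: chart_inv_def f_inv_into_f inv_into_into)

lemma chart_line:
  fixes c :: "('m, 'n::finite) chart"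
  assumes "is_chart X c" "p \<in> fst c"
  obtains r where "0 < r" "\<And>t. t \<in> ball 0 r \<Longrightarrow> snd c p + axis k t \<in> snd c ` fst c"
proof -
  have "open (snd c ` fst c)" "snd c p \<in> snd c ` fst c"
    using assms by (auto simp: is_chart_def)
  \<comment> \<open>The neighbourhood lemma for a constant curve; \<open>t\<close> is a dummy
    variable.\<close>
  then obtain r where r: "0 < r"
    "\<And>t z. t \<in> cball 0 r \<Longrightarrow> z \<in> cball 0 r \<Longrightarrow> snd c p + axis k z \<in> snd c ` fst c"
    by (rule open_product_nbhd[OF _ open_UNIV UNIV_I, of "\<lambda>_. snd c p" _ k, rotated]) simp_all
  show ?thesis
    by (rule that[OF r(1)], rule r(2)[of 0]) (use r(1) in auto)
qed

lemma eventually_chart_line: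
  fixes c :: "('m, 'n::finite) chart"
  assumes "is_chart X c" "p \<in> fst c"
  shows "\<forall>\<^sub>F t in nhds 0. snd c p + axis k t \<in> snd c ` fst c"
proof -
  obtain r where r: "0 < r" "\<And>t. t \<in> ball 0 r \<Longrightarrow> snd c p + axis k t \<in> snd c ` fst c"
    by (rule chart_line[OF assms]) blast
  show ?thesis
    using eventually_nhds_ball[OF r(1), of 0] by eventually_elim (rule r(2))
qed

text \<open>A derivative at 0 depends only on the germ there. This transfers identities known on the
  chart domain to \<open>pd\<close>, whose integrand-free line may leave the domain for large
  \<open>t\<close>.\<close>

lemma eventually_eq_on_chart_line:
  fixes c :: "('m, 'n::finite) chart"
  assumes c: "is_chart X c" "p \<in> fst c" and eq: "\<And>q. q \<in> fst c \<Longrightarrow> f q = g q"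
  shows "\<forall>\<^sub>F t in nhds 0. f (chart_inv c (snd c p + axis k t)) = g (chart_inv c (snd c p + axis k t))"
  using eventually_chart_line[OF c] by eventually_elim (rule eq, rule chart_inv_right(2))

lemma pd_cong:
  assumes "is_chart X c" "p \<in> fst c" "\<And>q. q \<in> fst c \<Longrightarrow> f q = g q"
  shows "pd c k f p = pd c k g p"
  unfolding pd_def by (intro deriv_cong_ev eventually_eq_on_chart_line[OF assms] refl)

lemma coordinate_line_derivative:
  assumes "is_chart X c" "p \<in> fst c"
  shows "((\<lambda>t. snd c (chart_inv c (snd c p + axis k t)) $ j) has_field_derivative
    (if j = k then 1 else 0)) (at 0)"
proof -
  have "\<forall>\<^sub>F t in nhds 0. snd c (chart_inv c (snd c p + axis k t)) $ j = (snd c p + axis k t) $ j"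
    using eventually_chart_line[OF assms, of k] by eventually_elim (simp add: chart_inv_right(1))
  from DERIV_cong_ev[OF refl this refl] show ?thesis
    using has_field_derivative_axis by (rule iffD2)
qed

lemma jacobian_self:
  assumes "is_chart X c" "p \<in> fst c"
  shows "jacobian c c p = mat 1"
  using DERIV_imp_deriv[OF coordinate_line_derivative[OF assms]]
  by (simp add: jacobian_def pd_def mat_def vec_eq_iff)

text \<open>Expressed in the coordinates \<open>c\<close>, a coordinate line of \<open>d\<close> is
  a holomorphic curve with velocity a column of the Jacobian, so
  \<open>holo_on_partial_chain\<close> applies.\<close>

lemma pd_chain:
  fixes c d :: "('m, 'n::finite) chart"
  assumes c: "is_chart X c" and d: "is_chart X d" "fst d = fst c" "transition_holo d c"
    and f: "holo_chart c f" and p: "p \<in> fst c"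
  shows "((\<lambda>t. pd c l f (chart_inv d (snd d p + axis k t))) has_field_derivative
    (\<Sum>s\<in>UNIV. jacobian d c p $ s $ k * pd c s (pd c l f) p)) (at 0)"
proof -
  define x where "x t = snd c (chart_inv d (snd d p + axis k t))" for t
  have inv0: "chart_inv d (snd d p + axis k 0) = p"
    using chart_inv_left[OF d(1)] p d(2) by (simp add: iffD2[OF axis_eq_0_iff])
  have x0: "x 0 = snd c p"
    by (simp add: x_def inv0)
  obtain r where r: "0 < r" "\<And>t. t \<in> ball 0 r \<Longrightarrow> snd d p + axis k t \<in> snd d ` fst d"
    by (rule chart_line[OF d(1), of p k]) (use p d(2) in auto)
  have xhol: "(\<lambda>t. x t $ j) holomorphic_on ball 0 r" for j
  proof -
    have hj: "holo_on (\<lambda>y. snd c (chart_inv d y) $ j) (snd d ` fst d)"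
      using d(2,3) unfolding transition_holo_def by simp
    have "((\<lambda>t. snd c (chart_inv d (snd d p + axis k t)) $ j) has_field_derivative
      (\<Sum>i\<in>UNIV. (if i = k then 1 else 0) *
         deriv (\<lambda>z. snd c (chart_inv d (snd d p + axis k t + axis i z)) $ j) 0)) (at t)"
      if "t \<in> ball 0 r" for t
      by (rule holo_on_chain[where x = "\<lambda>t. snd d p + axis k t", OF hj r(2)[OF that]
          has_field_derivative_axis])
    then show ?thesis
      unfolding x_def by (intro holomorphic_onI) (auto simp: field_differentiable_def
          intro: has_field_derivative_at_within simp del: vector_add_component)
  qed
  \<comment> \<open>A nested \<open>pd\<close> recomputes the coordinates of its moving base point;
    near 0 they are the expected ones, since \<open>chart_inv c\<close> is there a right inverse of
    the chart.\<close>
  have second: "deriv (\<lambda>z. deriv (\<lambda>w. (f \<circ> chart_inv c) (x 0 + axis s z + axis l w)) 0) 0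
      = pd c s (pd c l f) p" for s
  proof -
    show ?thesis
      unfolding pd_def x0
    proof (rule deriv_cong_ev[OF _ refl])
      show "\<forall>\<^sub>F z in nhds 0. deriv (\<lambda>w. (f \<circ> chart_inv c) (snd c p + axis s z + axis l w)) 0 =
        deriv (\<lambda>t. f (chart_inv c (snd c (chart_inv c (snd c p + axis s z)) + axis l t))) 0"
        using eventually_chart_line[OF c p, of s] by eventually_elim (simp add: chart_inv_right(1))
    qed
  qed
  have "((\<lambda>t. deriv (\<lambda>z. (f \<circ> chart_inv c) (x t + axis l z)) 0) has_field_derivative
     (\<Sum>s\<in>UNIV. deriv (\<lambda>t. x t $ s) 0 *
        deriv (\<lambda>z. deriv (\<lambda>w. (f \<circ> chart_inv c) (x 0 + axis s z + axis l w)) 0) 0)) (at 0)"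
  proof (rule holo_on_partial_chain)
    show "holo_on (f \<circ> chart_inv c) (snd c ` fst c)"
      using f by (simp add: holo_chart_def)
    show "open (snd c ` fst c)"
      using c by (simp add: is_chart_def)
    show "x 0 \<in> snd c ` fst c"
      using p x0 by simp
    show "0 \<in> ball 0 r" "open (ball 0 r)"
      using r(1) by auto
  qed (rule xhol)
  then show ?thesis
    unfolding second by (simp add: pd_def x_def jacobian_def)
qed

section \<open>Components of the algebra and linear algebra of the metric\<close>

lemma matrix_vector_mult_axis: "A *v axis k 1 = column k (A :: complex^'n::finite^'m)"
  by (simp add: matrix_vector_mult_def column_def axis_def mult_delta_right)

lemma mult_axis_left: "mult F c p (axis a 1) Y = sc F c p a *v Y"
proof -
  have "mult F c p (axis a 1) Y = (\<Sum>b\<in>UNIV. if b = a then sc F c p b *v Y else 0)"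
    unfolding mult_def by (intro sum.cong) (auto simp: axis_def)
  then show ?thesis
    by simp
qed

lemma mult_eq_sum: "mult F c p X Y = (\<Sum>a\<in>UNIV. X $ a *s mult F c p (axis a 1) Y)"
  by (simp add: mult_axis_left) (simp add: mult_def)

lemma pairing_axis: "pairing F c p (axis a 1) (axis b 1) = metric F c p $ a $ b"
  by (simp add: pairing_def axis_def mult_delta_right)

lemma pairing_zero_left: "pairing F c p 0 Y = 0"
  by (simp add: pairing_def)

lemma matrix_inv_mult:
  assumes "invertible (A :: complex^'n::finite^'n)"
  shows "A ** matrix_inv A = mat 1" "matrix_inv A ** A = mat 1"
proof -
  have "\<exists>B. A ** B = mat 1 \<and> B ** A = mat 1"
    using assms by (simp add: invertible_def)
  from someI_ex[OF this] show "A ** matrix_inv A = mat 1" "matrix_inv A ** A = mat 1"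
    by (simp_all add: matrix_inv_def)
qed

lemma invertible_if_kernel_zero:
  assumes "\<And>x. A *v x = 0 \<Longrightarrow> x = 0"
  shows "invertible (A :: complex^'n::finite^'n)"
  using assms matrix_left_invertible_ker[of A] invertible_left_inverse by blast

text \<open>Nondegeneracy in the first argument says that the transposed Gram matrix has trivial
  kernel.\<close>

lemma frobenius_metric_invertible:
  assumes "frobenius_algebra F c p"
  shows "invertible (metric F c p)"
proof -
  have "invertible (transpose (metric F c p))"
  proof (rule invertible_if_kernel_zero)
    fix X
    assume X: "transpose (metric F c p) *v X = 0"
    have "pairing F c p X Y = (\<Sum>b\<in>UNIV. (transpose (metric F c p) *v X) $ b * Y $ b)" for Y
      unfolding pairing_def
      by (subst sum.swap) (simp add: matrix_vector_mult_def transpose_def sum_distrib_right)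
    then have "pairing F c p X Y = 0" for Y
      by (simp only: X) simp
    then show "X = 0"
      using assms unfolding frobenius_algebra_def by blast
  qed
  then show ?thesis
    by (simp add: invertible_det_nz)
qed


section \<open>Comparison of the two structures on one flat chart\<close>

locale calibrated_chart =
  fixes M :: "('m, 'n::finite) frobenius_data"
    and D :: complex
    and B :: "'m set"
    and v :: "'m \<Rightarrow> complex^'n"
    and \<iota> \<kappa> :: 'n
    and \<eta> :: "complex^'n^'n"
    and \<mu> r :: "complex^'n"
    and Rs :: "nat \<Rightarrow> complex^'n^'n"
    and \<Theta> :: "'m \<Rightarrow> complex \<Rightarrow> complex^'n^'n"
    and \<theta> :: "'n \<Rightarrow> nat \<Rightarrow> 'm \<Rightarrow> complex"
    and \<Omega> :: "'n \<Rightarrow> nat \<Rightarrow> 'n \<Rightarrow> nat \<Rightarrow> 'm \<Rightarrow> complex"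
  assumes M: "frobenius_manifold M D"
    and flat: "flat_coordinates M D (B, v) \<iota> \<eta> \<mu> r"
    and calib: "calibration M (B, v) \<iota> \<eta> \<mu> Rs \<Theta> \<theta>"
    and two_point: "two_point_functions M (B, v) \<eta> \<theta> \<Omega>"
    and invertible_kappa: "\<forall>p\<in>B. invertible (sc M (B, v) p \<kappa>)"
begin

lemma chart_v: "(B, v) \<in> charts M"
  using flat by (simp add: flat_coordinates_def)

lemma metric_v: "p \<in> B \<Longrightarrow> metric M (B, v) p = \<eta>"
  using flat by (simp add: flat_coordinates_def)

lemma is_chart: "c \<in> charts M \<Longrightarrow> is_chart (space_of M) c"
  using M by (auto simp: frobenius_manifold_def complex_manifold_def)

lemma transition_holo: "c \<in> charts M \<Longrightarrow> d \<in> charts M \<Longrightarrow> transition_holo c d"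
  using M by (auto simp: frobenius_manifold_def complex_manifold_def compatible_def)

lemma algebra: "c \<in> charts M \<Longrightarrow> p \<in> fst c \<Longrightarrow> frobenius_algebra M c p"
  using M unfolding frobenius_manifold_def by blast

lemma tensorial_charts:
  assumes "c \<in> charts M" "d \<in> charts M" "p \<in> fst c" "p \<in> fst d"
  shows "mult M d p (jacobian c d p *v X) (jacobian c d p *v Y) = jacobian c d p *v mult M c p X Y"
    and "pairing M d p (jacobian c d p *v X) (jacobian c d p *v Y) = pairing M c p X Y"
  using M assms unfolding frobenius_manifold_def tensorial_def Let_def by blast+

text \<open>The Jacobian preserves the pairing, so a vector in its kernel pairs to zero with every
  vector.\<close>

lemma invertible_jacobian:
  assumes "c \<in> charts M" "d \<in> charts M" "p \<in> fst c" "p \<in> fst d"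
  shows "invertible (jacobian c d p)"
proof (rule invertible_if_kernel_zero)
  fix X
  assume "jacobian c d p *v X = 0"
  then have "pairing M c p X Y = 0" for Y
    using tensorial_charts(2)[OF assms, of X Y] by (simp add: pairing_zero_left)
  then show "X = 0"
    using algebra[OF assms(1,3)] unfolding frobenius_algebra_def by blast
qed

lemma
  assumes "p \<in> B"
  shows eta_inverse: "matrix_inv \<eta> ** \<eta> = mat 1" and eta_sym: "\<eta> $ a $ b = \<eta> $ b $ a"
proof -
  have A: "frobenius_algebra M (B, v) p"
    using algebra[OF chart_v] assms by simp
  show "matrix_inv \<eta> ** \<eta> = mat 1"
    using matrix_inv_mult(2) frobenius_metric_invertible[OF A] metric_v[OF assms] by metis
  have "pairing M (B, v) p (axis a 1) (axis b 1) = pairing M (B, v) p (axis b 1) (axis a 1)"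
    using A unfolding frobenius_algebra_def by blast
  then show "\<eta> $ a $ b = \<eta> $ b $ a"
    by (simp add: pairing_axis metric_v[OF assms])
qed

lemma sc_sym:
  assumes "p \<in> B"
  shows "sc M (B, v) p a $ g $ b = sc M (B, v) p b $ g $ a"
proof -
  have "mult M (B, v) p (axis a 1) (axis b 1) = mult M (B, v) p (axis b 1) (axis a 1)"
    using algebra[OF chart_v, of p] assms unfolding frobenius_algebra_def by simp
  then show ?thesis
    unfolding mult_axis_left
    by (simp add: vec_eq_iff matrix_vector_mult_def axis_def mult_delta_right)
qed

lemma pd_theta_0:
  assumes "p \<in> B"
  shows "pd (B, v) a (\<theta> b 0) p = \<eta> $ b $ a"
proof -
  have c: "is_chart (space_of M) (B, v)" "p \<in> fst (B, v)"
    using is_chart[OF chart_v] assms by auto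
  have "pd (B, v) a (\<theta> b 0) p = pd (B, v) a (\<lambda>q. \<Sum>\<rho>\<in>UNIV. \<eta> $ b $ \<rho> * v q $ \<rho>) p"
    by (rule pd_cong[OF c]) (use calib in \<open>simp add: calibration_def\<close>)
  also have "\<dots> = (\<Sum>\<rho>\<in>UNIV. \<eta> $ b $ \<rho> * (if \<rho> = a then 1 else 0))"
    unfolding pd_def using coordinate_line_derivative[OF c, of a]
    by (intro DERIV_imp_deriv DERIV_sum DERIV_cmult) simp
  finally show ?thesis
    by (simp add: mult_delta_right)
qed

text \<open>Compare the coefficients of z^(m+1) w^0: the term with \<open>w\<close>-index -1 counts
  as 0, and the gradient of \<open>\<theta> \<kappa> 0\<close>, a flat coordinate with lowered
  index, is the field \<partial>/\<partial>v^\<kappa>.\<close>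

lemma Omega_eq_pd:
  assumes "p \<in> B"
  shows "\<Omega> b m \<kappa> 0 p = pd (B, v) \<kappa> (\<theta> b (Suc m)) p"
proof -
  have "\<Omega> b m \<kappa> 0 p = grad_pairing M (B, v) (\<theta> b (Suc m)) (\<theta> \<kappa> 0) p"
  proof -
    have "(if Suc m = 0 then 0 else \<Omega> b (Suc m - 1) \<kappa> 0 p) +
        (if (0 :: nat) = 0 then 0 else \<Omega> b (Suc m) \<kappa> (0 - 1) p)
      = grad_pairing M (B, v) (\<theta> b (Suc m)) (\<theta> \<kappa> 0) p
        - (if Suc m = 0 \<and> (0 :: nat) = 0 then \<eta> $ b $ \<kappa> else 0)"
      using two_point assms unfolding two_point_functions_def fst_conv by blast
    then show ?thesis
      by simp
  qed
  also have "\<dots> = (\<Sum>i\<in>UNIV. pd (B, v) i (\<theta> b (Suc m)) p * (matrix_inv \<eta> ** \<eta>) $ i $ \<kappa>)"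
    unfolding grad_pairing_def metric_v[OF assms] pd_theta_0[OF assms] eta_sym[OF assms, of \<kappa>]
    by (simp add: matrix_matrix_mult_def sum_distrib_left mult_ac)
  also have "\<dots> = pd (B, v) \<kappa> (\<theta> b (Suc m)) p"
    unfolding eta_inverse[OF assms] by (simp add: mat_def mult_delta_right)
  finally show ?thesis .
qed

text \<open>The calibration equation turns second derivatives of \<open>\<theta> b (Suc m)\<close>
  into first derivatives of \<open>\<theta> b m\<close> contracted with the multiplication matrix.
  The chart \<open>x\<close> is arbitrary so that the old flat, the new flat and the canonical
  coordinates are all covered.\<close>

lemma Omega_line_derivative:
  assumes d: "(B, x) \<in> charts M" and p: "p \<in> B"
  shows "((\<lambda>t. \<Omega> b m \<kappa> 0 (chart_inv (B, x) (x p + axis k t))) has_field_derivative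
    (\<Sum>g\<in>UNIV. (sc M (B, v) p \<kappa> ** jacobian (B, x) (B, v) p) $ g $ k * pd (B, v) g (\<theta> b m) p)) (at 0)"
proof -
  have c: "is_chart (space_of M) (B, v)" and dc: "is_chart (space_of M) (B, x)"
    using is_chart chart_v d by auto
  have hol: "holo_chart (B, v) (\<theta> b (Suc m))"
    using calib unfolding calibration_def by blast
  \<comment> \<open>The calibration gives the matrix for index \<open>s\<close>; commutativity
    exchanges the lower indices and produces the one for \<kappa>.\<close>
  have second: "pd (B, v) s (pd (B, v) \<kappa> (\<theta> b (Suc m))) p =
      (\<Sum>g\<in>UNIV. sc M (B, v) p \<kappa> $ g $ s * pd (B, v) g (\<theta> b m) p)" for s
    using calib p unfolding calibration_def by (simp add: sc_sym[OF p, of _ _ \<kappa>])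
  have "((\<lambda>t. pd (B, v) \<kappa> (\<theta> b (Suc m)) (chart_inv (B, x) (snd (B, x) p + axis k t))) has_field_derivative
      (\<Sum>s\<in>UNIV. jacobian (B, x) (B, v) p $ s $ k * pd (B, v) s (pd (B, v) \<kappa> (\<theta> b (Suc m))) p)) (at 0)"
    by (rule pd_chain[OF c dc]) (use transition_holo d chart_v hol p in auto)
  also have "(\<Sum>s\<in>UNIV. jacobian (B, x) (B, v) p $ s $ k * pd (B, v) s (pd (B, v) \<kappa> (\<theta> b (Suc m))) p)
    = (\<Sum>g\<in>UNIV. (sc M (B, v) p \<kappa> ** jacobian (B, x) (B, v) p) $ g $ k * pd (B, v) g (\<theta> b m) p)"
    unfolding second sum_distrib_left
    by (subst sum.swap) (simp add: matrix_matrix_mult_def sum_distrib_left sum_distrib_right mult_ac)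
  finally have "((\<lambda>t. pd (B, v) \<kappa> (\<theta> b (Suc m)) (chart_inv (B, x) (snd (B, x) p + axis k t))) has_field_derivative
    (\<Sum>g\<in>UNIV. (sc M (B, v) p \<kappa> ** jacobian (B, x) (B, v) p) $ g $ k * pd (B, v) g (\<theta> b m) p)) (at 0)" .
  moreover have "\<forall>\<^sub>F t in nhds 0. \<Omega> b m \<kappa> 0 (chart_inv (B, x) (snd (B, x) p + axis k t)) =
      pd (B, v) \<kappa> (\<theta> b (Suc m)) (chart_inv (B, x) (snd (B, x) p + axis k t))"
    by (rule eventually_eq_on_chart_line[OF dc]) (use Omega_eq_pd p in auto)
  ultimately show ?thesis
    unfolding snd_conv by (rule iffD2[OF DERIV_cong_ev[OF refl _ refl], rotated])
qed

text \<open>The case \<open>m = 0\<close>: the partial derivatives of \<open>\<theta> a 0\<close>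
  are entries of \<eta>, which cancel against the inverse that raises the index.\<close>

lemma S_kappa_line_derivative:
  assumes d: "(B, x) \<in> charts M" and p: "p \<in> B"
  shows "((\<lambda>t. S_kappa_coordinates \<eta> \<Omega> \<kappa> (chart_inv (B, x) (x p + axis k t)) $ b) has_field_derivative
    (sc M (B, v) p \<kappa> ** jacobian (B, x) (B, v) p) $ b $ k) (at 0)"
proof -
  let ?CJ = "sc M (B, v) p \<kappa> ** jacobian (B, x) (B, v) p"
  have "((\<lambda>t. \<Sum>a\<in>UNIV. matrix_inv \<eta> $ b $ a * \<Omega> a 0 \<kappa> 0 (chart_inv (B, x) (x p + axis k t)))
     has_field_derivative
    (\<Sum>a\<in>UNIV. matrix_inv \<eta> $ b $ a * (\<Sum>g\<in>UNIV. ?CJ $ g $ k * pd (B, v) g (\<theta> a 0) p))) (at 0)"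
    by (intro DERIV_sum DERIV_cmult Omega_line_derivative assms)
  also have "(\<Sum>a\<in>UNIV. matrix_inv \<eta> $ b $ a * (\<Sum>g\<in>UNIV. ?CJ $ g $ k * pd (B, v) g (\<theta> a 0) p))
      = (\<Sum>g\<in>UNIV. (matrix_inv \<eta> ** \<eta>) $ b $ g * ?CJ $ g $ k)"
    unfolding pd_theta_0[OF p] sum_distrib_left
    by (subst sum.swap) (simp add: matrix_matrix_mult_def[of "matrix_inv \<eta>"] sum_distrib_right mult_ac)
  also have "\<dots> = ?CJ $ b $ k"
    by (simp add: eta_inverse[OF p] mat_def mult_delta_left)
  finally show ?thesis
    by (simp add: S_kappa_coordinates_def)
qed

lemma jacobian_S_kappa_coordinates:
  assumes "(B, x) \<in> charts M" "p \<in> B"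
  shows "jacobian (B, x) (B, S_kappa_coordinates \<eta> \<Omega> \<kappa>) p = sc M (B, v) p \<kappa> ** jacobian (B, x) (B, v) p"
  using DERIV_imp_deriv[OF S_kappa_line_derivative[OF assms]]
  by (simp add: jacobian_def[of _ "(B, S_kappa_coordinates \<eta> \<Omega> \<kappa>)"] pd_def vec_eq_iff)

lemma jacobian_v_S_kappa_coordinates:
  assumes "p \<in> B"
  shows "jacobian (B, v) (B, S_kappa_coordinates \<eta> \<Omega> \<kappa>) p = sc M (B, v) p \<kappa>"
  using jacobian_S_kappa_coordinates[OF chart_v assms] jacobian_self[OF is_chart[OF chart_v]] assms
  by simp

text \<open>In the new coordinates \<partial>/\<partial>v^a has components
  \<open>?C *v axis a 1\<close>. Multiplication by \<partial>/\<partial>v^\<kappa> sends the new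
  coordinate field with index \<open>a\<close> to \<partial>/\<partial>v^a, so the new Gram matrix
  is the old one.\<close>

lemma metric_S_kappa:
  assumes vh: "(B, S_kappa_coordinates \<eta> \<Omega> \<kappa>) \<in> charts M" and p: "p \<in> B"
  shows "metric (S_kappa M (B, v) \<kappa>) (B, S_kappa_coordinates \<eta> \<Omega> \<kappa>) p = \<eta>"
proof -
  let ?vh = "(B, S_kappa_coordinates \<eta> \<Omega> \<kappa>)" and ?C = "sc M (B, v) p \<kappa>"
  have C: "?C ** matrix_inv ?C = mat 1"
    using invertible_kappa p matrix_inv_mult(1) by blast
  have J: "jacobian (B, v) ?vh p = ?C"
    by (rule jacobian_v_S_kappa_coordinates[OF p])
  have col: "coord_field (B, v) \<kappa> ?vh p = ?C *v axis \<kappa> 1"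
    by (simp add: coord_field_def J matrix_vector_mult_axis)
  have "mult M ?vh p (coord_field (B, v) \<kappa> ?vh p) (axis a 1) = ?C *v axis a 1" for a
  proof -
    \<comment> \<open>Both factors are written as images under the Jacobian \<open>?C\<close>, as
      tensoriality requires.\<close>
    have "mult M ?vh p (?C *v axis \<kappa> 1) (?C *v (matrix_inv ?C *v axis a 1)) =
        ?C *v mult M (B, v) p (axis \<kappa> 1) (matrix_inv ?C *v axis a 1)"
      using tensorial_charts(1)[OF chart_v vh, of p] p by (simp add: J)
    then show ?thesis
      by (simp add: col mult_axis_left matrix_vector_mul_assoc C)
  qed
  then have "metric (S_kappa M (B, v) \<kappa>) ?vh p $ a $ b =
      pairing M ?vh p (?C *v axis a 1) (?C *v axis b 1)" for a b
    by (simp add: S_kappa_def)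
  also have "pairing M ?vh p (?C *v axis a 1) (?C *v axis b 1) = \<eta> $ a $ b" for a b
    using tensorial_charts(2)[OF chart_v vh, of p] p by (simp add: J pairing_axis metric_v)
  finally show ?thesis
    by (simp add: vec_eq_iff)
qed

text \<open>The multiplication matrix cancels the Jacobian from the new to the old coordinates.
  Hence corresponding partial derivatives of the two calibrations agree, and both Gram matrices are
  \<eta>.\<close>

lemma Theta_S_kappa:
  assumes vh: "(B, S_kappa_coordinates \<eta> \<Omega> \<kappa>) \<in> charts M" and p: "p \<in> B"
  shows "Theta_of (S_kappa M (B, v) \<kappa>) (B, S_kappa_coordinates \<eta> \<Omega> \<kappa>) (S_kappa_calibration \<Omega> \<kappa>) p
    = Theta_of M (B, v) \<theta> p"
proof -
  let ?vh = "(B, S_kappa_coordinates \<eta> \<Omega> \<kappa>)"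
  \<comment> \<open>The Jacobian formula with the new coordinates in place of \<open>x\<close>: its
    left side is the identity.\<close>
  have I: "sc M (B, v) p \<kappa> ** jacobian ?vh (B, v) p = mat 1"
    using jacobian_S_kappa_coordinates[OF vh p] jacobian_self[OF is_chart[OF vh]] p by simp
  have "pd ?vh k (S_kappa_calibration \<Omega> \<kappa> b m) p = pd (B, v) k (\<theta> b m) p" for k b m
    using DERIV_imp_deriv[OF Omega_line_derivative[OF vh p]]
    by (simp add: pd_def[of ?vh] S_kappa_calibration_def I mat_def mult_delta_left)
  then show ?thesis
    by (simp add: Theta_of_def Theta_coeff_def metric_S_kappa[OF assms] metric_v[OF p] fun_eq_iff)
qed

text \<open>\<open>Psi\<close> inverts the matrix of frame components, so these are compared
  instead. Passing to the new coordinates applies \<open>?C\<close>, which multiplies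
  \<partial>/\<partial>u_i by \<open>h p $ i * ?P $ i $ \<kappa>\<close>; the new factor, the
  inverse of \<open>?P $ i $ \<kappa>\<close>, restores \<open>h p $ i\<close>.\<close>

lemma Psi_S_kappa:
  assumes u: "canonical_coordinates M (B, u)" and h: "normalizing_factors M (B, u) h" and p: "p \<in> B"
  shows "Psi (B, S_kappa_coordinates \<eta> \<Omega> \<kappa>) (B, u) (S_kappa_factors (B, v) (B, u) h \<kappa>) p
    = Psi (B, v) (B, u) h p"
proof -
  let ?vh = "(B, S_kappa_coordinates \<eta> \<Omega> \<kappa>)" and ?C = "sc M (B, v) p \<kappa>"
  let ?J = "jacobian (B, u) (B, v) p" and ?P = "Psi (B, v) (B, u) h p"
  have cu: "(B, u) \<in> charts M" and
    idem: "mult M (B, u) p (axis i 1) (axis j 1) = (if i = j then axis j 1 else 0)" for i j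
    using u p by (auto simp: canonical_coordinates_def)
  have h0: "h p $ i \<noteq> 0" for i
  proof -
    have "(h p $ i)\<^sup>2 * pairing M (B, u) p (axis i 1) (axis i 1) = 1"
      using h p unfolding normalizing_factors_def by simp
    then show ?thesis
      by auto
  qed
  have mult_u: "mult M (B, u) p X (axis i 1) = X $ i *s axis i 1" for X i
  proof -
    have "mult M (B, u) p X (axis i 1) = (\<Sum>a\<in>UNIV. if a = i then X $ a *s axis i 1 else 0)"
      by (subst mult_eq_sum, unfold idem, intro sum.cong) auto
    then show ?thesis
      by simp
  qed
  define A :: "complex^'n^'n" where "A = ?J ** diag_matrix (h p)"
  have A_eq: "(\<chi> \<beta> i. h p $ i * coord_field (B, u) i (B, v) p $ \<beta>) = A"
    by (simp add: A_def coord_field_def column_def diag_matrix_def matrix_matrix_mult_def vec_eq_iff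
        mult_delta_right mult.commute[of "h p $ _"])
  have J: "invertible ?J"
    using invertible_jacobian[OF cu chart_v] p by simp
  have "invertible (diag_matrix (h p))"
    by (rule invertible_if_kernel_zero)
      (simp add: diag_matrix_def matrix_vector_mult_def mult_delta_left vec_eq_iff h0)
  then have "invertible A"
    unfolding A_def by (intro invertible_mult J)
  then have AP: "A ** ?P = mat 1"
    unfolding Psi_def A_eq by (rule matrix_inv_mult)
  \<comment> \<open>The canonical components of \<partial>/\<partial>v^\<kappa>, which are the
    eigenvalues of \<open>?C\<close> on the idempotents.\<close>
  define X :: "complex^'n" where "X = (\<chi> i. h p $ i * ?P $ i $ \<kappa>)"
  have "?J *v X = A *v (?P *v axis \<kappa> 1)"
  proof -
    have "X = diag_matrix (h p) *v (?P *v axis \<kappa> 1)"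
      unfolding matrix_vector_mult_axis
      by (simp add: X_def column_def matrix_vector_mult_def diag_matrix_def mult_delta_left vec_eq_iff)
    then show ?thesis
      by (simp add: A_def matrix_vector_mul_assoc matrix_mul_assoc)
  qed
  then have JX: "?J *v X = axis \<kappa> 1"
    by (simp add: matrix_vector_mul_assoc AP)
  have CJ: "?C *v (?J *v axis i 1) = X $ i *s (?J *v axis i 1)" for i
    using tensorial_charts(1)[OF cu chart_v, of p X "axis i 1"] p
    by (simp add: JX mult_axis_left mult_u vector_scalar_commute)
  \<comment> \<open>Otherwise \<open>?C\<close> would annihilate \<partial>/\<partial>u_i. This is
    what makes the total function \<open>inverse\<close> in \<open>S_kappa_factors\<close> a genuine
    reciprocal.\<close>
  have P0: "?P $ i $ \<kappa> \<noteq> 0" for i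
  proof
    assume "?P $ i $ \<kappa> = 0"
    then have "?C *v (?J *v axis i 1) = 0"
      by (simp add: CJ X_def)
    moreover have "invertible (?C ** ?J)"
      using invertible_kappa p J by (intro invertible_mult) auto
    then have "\<forall>x. (?C ** ?J) *v x = 0 \<longrightarrow> x = 0"
      using matrix_left_invertible_ker[of "?C ** ?J"] invertible_left_inverse by blast
    ultimately have "axis i 1 = (0 :: complex^'n)"
      unfolding matrix_vector_mul_assoc by blast
    then show False
      by (simp add: axis_eq_0_iff)
  qed
  have "(\<chi> \<beta> i. S_kappa_factors (B, v) (B, u) h \<kappa> p $ i * coord_field (B, u) i ?vh p $ \<beta>) $ b $ i = A $ b $ i"
    for b i
  proof -
    have "(?C ** ?J) $ b $ i = (X $ i *s (?J *v axis i 1)) $ b"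
      unfolding CJ[symmetric] unfolding matrix_vector_mult_axis
      by (simp add: column_def matrix_matrix_mult_def matrix_vector_mult_def)
    also have "\<dots> = ?P $ i $ \<kappa> * (?J $ b $ i * h p $ i)"
      by (simp add: X_def matrix_vector_mult_axis column_def)
    also have "?J $ b $ i * h p $ i = A $ b $ i"
      by (simp add: A_def diag_matrix_def matrix_matrix_mult_def mult_delta_right)
    finally show ?thesis
      using P0[of i]
      by (simp add: S_kappa_factors_def coord_field_def column_def jacobian_S_kappa_coordinates[OF cu p])
  qed
  then have "(\<chi> \<beta> i. S_kappa_factors (B, v) (B, u) h \<kappa> p $ i * coord_field (B, u) i ?vh p $ \<beta>) = A"
    by (simp add: vec_eq_iff)
  then show ?thesis
    unfolding Psi_def A_eq by simp
qed

end


section \<open>Uniqueness of formal and sectorial solutions\<close>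

text \<open>The step from \<open>k\<close> to \<open>k + 1\<close> determines the off-diagonal entries; the diagonal ones come from the
  diagonal of the next equation, since the equation for \<open>k = 0\<close> forces \<open>V\<close> to have zero diagonal.\<close>
lemma formal_recursion_unique:
  fixes P Q :: "nat \<Rightarrow> complex^'n::finite^'n" and u :: "complex^'n"
  assumes u: "inj (\<lambda>i. u $ i)" and P0: "P 0 = mat 1" and Q0: "Q 0 = mat 1"
    and P: "\<And>k. P (Suc k) ** diag_matrix u - scale_matrix (of_nat k) (P k)
      = diag_matrix u ** P (Suc k) + V ** P k"
    and Q: "\<And>k. Q (Suc k) ** diag_matrix u - scale_matrix (of_nat k) (Q k)
      = diag_matrix u ** Q (Suc k) + V ** Q k"
  shows "P = Q"
proof -
  have entry: "X (Suc k) $ a $ b * (u $ b - u $ a) = of_nat k * X k $ a $ b + (V ** X k) $ a $ b"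
    if X: "\<And>k. X (Suc k) ** diag_matrix u - scale_matrix (of_nat k) (X k)
      = diag_matrix u ** X (Suc k) + V ** X k" for X :: "nat \<Rightarrow> complex^'n^'n" and k a b
  proof -
    have "(X (Suc k) ** diag_matrix u - scale_matrix (of_nat k) (X k)) $ a $ b
      = (diag_matrix u ** X (Suc k)) $ a $ b + (V ** X k) $ a $ b"
      by (simp add: X)
    then show ?thesis
      by (simp add: diag_matrix_def scale_matrix_def matrix_matrix_mult_def[of "X (Suc k)"]
        matrix_matrix_mult_def[of _ "X (Suc k)"] mult_delta_right mult_delta_left algebra_simps)
  qed
  have V: "V $ a $ a = 0" for a
    using entry[OF P, of 0 a a] by (simp add: P0)
  have "P k = Q k" for k
  proof (induction k)
    case (Suc k)
    have off: "P (Suc k) $ a $ b = Q (Suc k) $ a $ b" if "a \<noteq> b" for a b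
    proof -
      have "u $ b - u $ a \<noteq> 0"
        using u that by (auto dest: injD)
      then show ?thesis
        using entry[OF P, of k a b] entry[OF Q, of k a b] Suc by (metis mult_right_cancel)
    qed
    have diag: "P (Suc k) $ a $ a = Q (Suc k) $ a $ a" for a
    proof -
      \<comment> \<open>As \<open>V $ a $ a = 0\<close>, only off-diagonal entries of
        \<open>P (Suc k)\<close> and \<open>Q (Suc k)\<close> contribute.\<close>
      have "(V ** P (Suc k)) $ a $ a = (V ** Q (Suc k)) $ a $ a"
        unfolding matrix_matrix_mult_def using off V by (auto intro!: sum.cong) (metis mult_zero_left)
      then have "of_nat (Suc k) * P (Suc k) $ a $ a = of_nat (Suc k) * Q (Suc k) $ a $ a"
        using entry[OF P, of "Suc k" a a] entry[OF Q, of "Suc k" a a]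
        by (metis add_right_cancel diff_self mult_zero_right)
      then show ?thesis
        by (simp del: of_nat_Suc)
    qed
    show ?case
      using off diag by (auto simp: vec_eq_iff) metis
  qed (simp add: P0 Q0)
  then show ?thesis
    by blast
qed

lemma normalized_formal_solution_start:
  assumes "normalized_formal_solution cv cu h \<mu> Y" "p \<in> fst cu"
  shows "fst (Y p) 0 = mat 1" "snd (Y p) = snd cu p"
  using assms by (simp_all add: normalized_formal_solution_def Let_def)

text \<open>The recursion in \<open>z\<close> sees the data only through \<open>u\<close> and
  \<open>V\<close>, so solutions from different flat charts and frames can be compared.\<close>

lemma normalized_formal_solution_unique:
  assumes Y: "normalized_formal_solution cv cu h \<mu> Y" and Y': "normalized_formal_solution cv' cu h' \<mu>' Y'"
    and p: "p \<in> fst cu" and V: "V_matrix cv cu h \<mu> p = V_matrix cv' cu h' \<mu>' p"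
    and u: "inj (\<lambda>i. snd cu p $ i)"
  shows "Y p = Y' p"
proof -
  have "fst (Y p) = fst (Y' p)"
    by (rule formal_recursion_unique[OF u, where V = "V_matrix cv cu h \<mu> p"])
      (use Y Y' p V in \<open>simp_all add: normalized_formal_solution_def Let_def\<close>)
  then show ?thesis
    using normalized_formal_solution_start(2)[OF Y p] normalized_formal_solution_start(2)[OF Y' p]
    by (simp add: prod_eq_iff)
qed

section \<open>Linear systems and their fundamental solutions\<close>

text \<open>Quotients of determinants make holomorphy and limits pass from \<open>F\<close> and
  \<open>G\<close> to \<open>K\<close>.\<close>

lemma cramer_solution:
  fixes F G K :: "complex^'n::finite^'n"
  assumes "invertible F" "G = F ** K"
  shows "K $ k $ j = det (\<chi> i l. if l = k then G $ i $ j else F $ i $ l) / det F"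
proof -
  have "F *v column j K = column j G"
    by (simp add: assms(2) matrix_vector_mult_def matrix_matrix_mult_def column_def vec_eq_iff)
  then have "column j K = (\<chi> k. det (\<chi> i l. if l = k then column j G $ i else F $ i $ l) / det F)"
    using assms(1) by (subst (asm) cramer) (auto simp: invertible_det_nz)
  then have "column j K $ k = det (\<chi> i l. if l = k then column j G $ i else F $ i $ l) / det F"
    by simp
  then show ?thesis
    by (simp add: column_def cong: if_cong)
qed

lemma holomorphic_on_det:
  assumes "\<And>i j. (\<lambda>z. A z $ i $ j) holomorphic_on S"
  shows "(\<lambda>z. det (A z :: complex^'n::finite^'n)) holomorphic_on S"
  unfolding det_def by (intro holomorphic_intros assms)

lemma tendsto_det:
  assumes "\<And>i j. ((\<lambda>x. A x $ i $ j) \<longlongrightarrow> L $ i $ j) F"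
  shows "((\<lambda>x. det (A x)) \<longlongrightarrow> det (L :: complex^'n::finite^'n)) F"
  unfolding det_def by (intro tendsto_intros assms)

text \<open>Cramer's quotient is continuous where the denominator is \<open>det (mat 1) = 1\<close>;
  its limit is Cramer's formula for the identity matrices.\<close>

lemma tendsto_mat_1_cancel:
  fixes F G K :: "'a \<Rightarrow> complex^'n::finite^'n"
  assumes inv: "\<forall>\<^sub>F x in X. invertible (F x) \<and> G x = F x ** K x"
    and F: "\<And>i j. ((\<lambda>x. F x $ i $ j) \<longlongrightarrow> mat 1 $ i $ j) X"
    and G: "\<And>i j. ((\<lambda>x. G x $ i $ j) \<longlongrightarrow> mat 1 $ i $ j) X"
  shows "((\<lambda>x. K x $ k $ j) \<longlongrightarrow> mat 1 $ k $ j) X"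
proof -
  let ?I = "mat 1 :: complex^'n^'n"
  have entries: "((\<lambda>x. (\<chi> i l. if l = k then G x $ i $ j else F x $ i $ l) $ i $ l) \<longlongrightarrow>
      (\<chi> i l. if l = k then ?I $ i $ j else ?I $ i $ l) $ i $ l) X" for i l
    using F G by (cases "l = k") auto
  have "((\<lambda>x. det (\<chi> i l. if l = k then G x $ i $ j else F x $ i $ l) / det (F x)) \<longlongrightarrow>
      det (\<chi> i l. if l = k then ?I $ i $ j else ?I $ i $ l) / det ?I) X"
    by (intro tendsto_divide tendsto_det F entries) simp
  also have "det (\<chi> i l. if l = k then ?I $ i $ j else ?I $ i $ l) / det ?I = ?I $ k $ j"
    by (rule cramer_solution[symmetric]) (simp_all add: invertible_det_nz)
  finally have lim: "((\<lambda>x. det (\<chi> i l. if l = k then G x $ i $ j else F x $ i $ l) / det (F x))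
      \<longlongrightarrow> ?I $ k $ j) X" .
  have "\<forall>\<^sub>F x in X. det (\<chi> i l. if l = k then G x $ i $ j else F x $ i $ l) / det (F x) = K x $ k $ j"
    using inv by eventually_elim (blast intro: cramer_solution[symmetric])
  then show ?thesis
    using lim by (rule Lim_transform_eventually[rotated])
qed

lemma invertible_mult_left_cancel:
  assumes "invertible (A :: complex^'n::finite^'n)" "A ** X = A ** X'"
  shows "X = X'"
  using assms matrix_inv_mult(2) by (metis matrix_mul_assoc matrix_mul_lid)

text \<open>Differentiating \<open>G z = F z ** K z\<close> and using both equations leaves
  \<open>F z ** K' z = 0\<close>; convexity then makes \<open>K\<close> constant. Cramer's rule
  supplies the differentiability of \<open>K\<close>.\<close>

lemma linear_ode_solution_space:
  fixes F G A :: "complex \<Rightarrow> complex^'n::finite^'n"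
  assumes S: "open S" "convex S"
    and F: "\<And>z i j. z \<in> S \<Longrightarrow> ((\<lambda>w. F w $ i $ j) has_field_derivative (A z ** F z) $ i $ j) (at z)"
    and G: "\<And>z i j. z \<in> S \<Longrightarrow> ((\<lambda>w. G w $ i $ j) has_field_derivative (A z ** G z) $ i $ j) (at z)"
    and inv: "\<And>z. z \<in> S \<Longrightarrow> invertible (F z)"
  obtains K where "\<And>z. z \<in> S \<Longrightarrow> G z = F z ** K"
proof -
  define K where "K z = matrix_inv (F z) ** G z" for z
  have GK: "G z = F z ** K z" if "z \<in> S" for z
    using matrix_inv_mult(1)[OF inv[OF that]] by (simp add: K_def matrix_mul_assoc)
  have holF: "(\<lambda>w. F w $ i $ j) holomorphic_on S" for i j
    unfolding holomorphic_on_open[OF S(1)] by (intro ballI exI) (rule F)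
  have holG: "(\<lambda>w. G w $ i $ j) holomorphic_on S" for i j
    unfolding holomorphic_on_open[OF S(1)] by (intro ballI exI) (rule G)
  have holK: "(\<lambda>w. K w $ k $ j) holomorphic_on S" for k j
  proof (rule holomorphic_transform)
    have "(\<lambda>w. (\<chi> i l. if l = k then G w $ i $ j else F w $ i $ l) $ i $ l) holomorphic_on S" for i l
      using holF holG by (cases "l = k") auto
    then show "(\<lambda>w. det (\<chi> i l. if l = k then G w $ i $ j else F w $ i $ l) / det (F w)) holomorphic_on S"
      using inv by (intro holomorphic_intros holomorphic_on_det holF) (auto simp: invertible_det_nz)
  qed (rule cramer_solution[symmetric, OF inv GK])
  define K' where "K' z = (\<chi> i j. deriv (\<lambda>w. K w $ i $ j) z)" for z
  have dK: "((\<lambda>w. K w $ i $ j) has_field_derivative K' z $ i $ j) (at z)" if "z \<in> S" for z i j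
    using holomorphic_derivI[OF holK S(1) that] by (simp add: K'_def)
  have "F z ** K' z = 0" if z: "z \<in> S" for z
  proof -
    have "(F z ** K' z) $ i $ j = 0" for i j
    proof -
      have "((\<lambda>w. (F w ** K w) $ i $ j) has_field_derivative
          (\<Sum>k\<in>UNIV. (A z ** F z) $ i $ k * K z $ k $ j + K' z $ k $ j * F z $ i $ k)) (at z)"
        unfolding matrix_matrix_mult_def[of "F _"] using F[OF z] dK[OF z]
        by (auto intro!: derivative_eq_intros simp: algebra_simps)
      moreover have "\<forall>\<^sub>F w in nhds z. (F w ** K w) $ i $ j = G w $ i $ j"
        using eventually_nhds_in_open[OF S(1) z] by eventually_elim (simp add: GK)
      ultimately have dG: "((\<lambda>w. G w $ i $ j) has_field_derivative
          (\<Sum>k\<in>UNIV. (A z ** F z) $ i $ k * K z $ k $ j + K' z $ k $ j * F z $ i $ k)) (at z)"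
        by (rule iffD1[OF DERIV_cong_ev[OF refl _ refl], rotated])
      have "(\<Sum>k\<in>UNIV. (A z ** F z) $ i $ k * K z $ k $ j + K' z $ k $ j * F z $ i $ k)
          = (A z ** G z) $ i $ j + (F z ** K' z) $ i $ j"
        by (simp add: GK[OF z] matrix_mul_assoc sum.distrib matrix_matrix_mult_def[of "A z ** F z"]
            matrix_matrix_mult_def[of _ "K' z"] mult.commute)
      with DERIV_unique[OF dG G[OF z, of i j]] show ?thesis
        by simp
    qed
    then show ?thesis
      by (simp add: vec_eq_iff)
  qed
  then have K'0: "K' z = 0" if "z \<in> S" for z
    using invertible_mult_left_cancel[OF inv[OF that], of "K' z" 0] that by simp
  have "\<exists>c. \<forall>z\<in>S. K z $ i $ j = c" for i j
  proof (rule has_field_derivative_zero_constant[OF S(2)])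
    show "((\<lambda>z. K z $ i $ j) has_field_derivative 0) (at z within S)" if "z \<in> S" for z
      using dK[OF that, of i j] K'0[OF that] by (simp add: has_field_derivative_at_within)
  qed
  then have "\<forall>i. \<exists>f. \<forall>j. \<forall>z\<in>S. K z $ i $ j = f j"
    by (intro allI choice)
  from choice[OF this] obtain c where c: "\<forall>i j. \<forall>z\<in>S. K z $ i $ j = c i j" ..
  show ?thesis
    by (rule that[of "\<chi> i j. c i j"]) (simp add: GK c vec_eq_iff matrix_matrix_mult_def)
qed

section \<open>Sectors and solutions with prescribed asymptotics\<close>

lemma polar_in_open_sector:
  assumes "0 < r" "a < t" "t < b"
  shows "of_real r * cis t \<in> open_sector a b"
  using assms unfolding open_sector_def by blast

lemma cis_in_open_sector: "a < t \<Longrightarrow> t < b \<Longrightarrow> cis t \<in> open_sector a b"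
  using polar_in_open_sector[of 1 a t b] by simp

lemma exp_strip_in_sector: "a < Im w \<Longrightarrow> Im w < b \<Longrightarrow> exp w \<in> open_sector a b"
  using polar_in_open_sector[of "exp (Re w)" a "Im w" b] by (simp add: exp_eq_polar)

text \<open>The asymptotic condition with \<open>N = 1\<close> on the degenerate closed sector
  consisting of one ray: the partial sum is the leading coefficient 1, and the error is
  O(1/z).\<close>

lemma sectorial_solution_tendsto:
  fixes Y :: "'n::finite formal_matrix"
  assumes W: "sectorial_solution V Y a b W" and Y: "fst Y 0 = mat 1" and t: "a < t" "t < b"
  shows "((\<lambda>r. (W (of_real r * cis t) ** diag_matrix (\<chi> i. exp (- (of_real r * cis t) * snd Y $ i))) $ i $ j)
    \<longlongrightarrow> mat 1 $ i $ j) at_top"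
proof -
  let ?F = "inf at_infinity (principal (closed_sector t t))"
  let ?f = "\<lambda>z. (W z ** diag_matrix (\<chi> i. exp (- z * snd Y $ i)) - mat 1) $ i $ j"
  have one: "scale_matrix 1 A = A" for A :: "complex^'n^'n"
    by (simp add: scale_matrix_def vec_eq_iff)
  have "?f \<in> O[?F](\<lambda>z. 1 / z ^ 1)"
    using W t unfolding sectorial_solution_def asymptotic_in_sector_def
    by (auto simp: Y one dest!: spec[of _ t] spec[of _ "1 :: nat"])
  moreover have inf: "filterlim (\<lambda>r. of_real r * cis t) at_infinity at_top"
    by (rule filterlim_norm_at_top_imp_at_infinity)
      (simp add: norm_mult filterlim_abs_real filterlim_ident)
  have "filterlim (\<lambda>r. of_real r * cis t) (principal (closed_sector t t)) at_top"
    unfolding filterlim_principal closed_sector_def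
    using eventually_gt_at_top[of 0] by eventually_elim auto
  with inf have "filterlim (\<lambda>r. of_real r * cis t) ?F at_top"
    by (simp add: filterlim_inf)
  ultimately have "(\<lambda>r. ?f (of_real r * cis t)) \<in> O(\<lambda>r. 1 / (of_real r * cis t) ^ 1)"
    by (rule landau_o.big.compose)
  then obtain c where "\<forall>\<^sub>F r in at_top. norm (?f (of_real r * cis t)) \<le> c * norm (1 / (of_real r * cis t) ^ 1)"
    by (rule landau_o.bigE)
  moreover have "((\<lambda>r. inverse (of_real r * cis t)) \<longlongrightarrow> 0) at_top"
    by (rule filterlim_compose[OF tendsto_inverse_0 inf])
  then have "((\<lambda>r. c * norm (1 / (of_real r * cis t) ^ 1)) \<longlongrightarrow> 0) at_top"
    by (simp add: tendsto_mult_right_zero tendsto_norm_zero inverse_eq_divide)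
  ultimately have "((\<lambda>r. ?f (of_real r * cis t)) \<longlongrightarrow> 0) at_top"
    by (rule Lim_null_comparison)
  then show ?thesis
    by (simp add: Lim_null[symmetric])
qed

lemma sectorial_solution_subsector:
  assumes "sectorial_solution V Y a b W" "a \<le> a'" "b' \<le> b"
  shows "sectorial_solution V Y a' b' W"
proof -
  have "open_sector a' b' \<subseteq> open_sector a b"
    using assms(2,3) unfolding open_sector_def by fastforce
  then show ?thesis
    using assms unfolding sectorial_solution_def asymptotic_in_sector_def by force
qed

text \<open>Substitution of \<open>exp w\<close> for \<open>z\<close>; the chain rule factor
  \<open>exp w\<close> joins the coefficient matrix.\<close>

lemma sectorial_solution_log:
  assumes "sectorial_solution V Y a b W" "a < Im w" "Im w < b"
  shows "((\<lambda>w. W (exp w) $ i $ j) has_field_derivative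
    (scale_matrix (exp w) (diag_matrix (snd Y) + scale_matrix (1 / exp w) V) ** W (exp w)) $ i $ j) (at w)"
proof -
  have "((\<lambda>w. W w $ i $ j) has_field_derivative
      ((diag_matrix (snd Y) + scale_matrix (1 / exp w) V) ** W (exp w)) $ i $ j) (at (exp w))"
    using assms(1) exp_strip_in_sector[OF assms(2,3)] unfolding sectorial_solution_def by blast
  from DERIV_chain2[OF this DERIV_exp] show ?thesis
    by (simp add: scale_matrix_def matrix_matrix_mult_def sum_distrib_left mult_ac)
qed

text \<open>Two solutions differ by a constant right factor \<open>K\<close> with \<open>e\<^sup>z\<^sup>U K e\<^sup>-\<^sup>z\<^sup>U \<longrightarrow> 1\<close>. As the sector contains both
  halves of an admissible line, every off-diagonal entry of \<open>K\<close> is multiplied by an exponential that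
  does not decay along one of them, so it vanishes.\<close>
lemma sectorial_solution_unique:
  fixes Y :: "'n::finite formal_matrix"
  assumes W: "sectorial_solution V Y a b W" and W': "sectorial_solution V Y a b W'"
    and Y: "fst Y 0 = mat 1" and t: "a < t" "t + pi < b"
    and re: "\<And>i j. i \<noteq> j \<Longrightarrow> Re (cis t * (snd Y $ i - snd Y $ j)) \<noteq> 0"
    and z: "z \<in> open_sector a b"
  shows "W' z = W z"
proof -
  \<comment> \<open>The sector opens wider than pi and is not convex; the strip of logarithms
    is.\<close>
  define S where "S = {w. a < Im w \<and> Im w < b}"
  have S_eq: "S = {w. Im w > a} \<inter> {w. Im w < b}"
    by (auto simp: S_def)
  have "open S" "convex S"
    unfolding S_eq
    by (auto intro!: open_Int convex_Int open_halfspace_Im_gt open_halfspace_Im_lt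
        convex_halfspace_Im_gt convex_halfspace_Im_lt)
  then obtain K where K: "\<And>w. w \<in> S \<Longrightarrow> W' (exp w) = W (exp w) ** K"
  proof (rule linear_ode_solution_space[where F = "\<lambda>w. W (exp w)" and G = "\<lambda>w. W' (exp w)"
        and A = "\<lambda>w. scale_matrix (exp w) (diag_matrix (snd Y) + scale_matrix (1 / exp w) V)"])
    show "invertible (W (exp w))" if "w \<in> S" for w
      using W exp_strip_in_sector[of a w b] that unfolding sectorial_solution_def S_def by blast
  qed (use sectorial_solution_log[OF W] sectorial_solution_log[OF W'] S_def in auto)
  have WK: "W' (of_real r * cis s) = W (of_real r * cis s) ** K" "invertible (W (of_real r * cis s))"
    if "0 < r" "a < s" "s < b" for r s
  proof -
    have e: "exp (Complex (ln r) s) = of_real r * cis s"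
      using that by (simp add: exp_eq_polar)
    have m: "Complex (ln r) s \<in> S"
      using that by (simp add: S_def)
    show "W' (of_real r * cis s) = W (of_real r * cis s) ** K"
      using K[OF m] by (simp add: e)
    show "invertible (W (of_real r * cis s))"
      using W that unfolding sectorial_solution_def open_sector_def by blast
  qed
  define E where "E c = diag_matrix (\<chi> i. exp (c * snd Y $ i))" for c :: complex
  have E: "E (- c) ** E c = mat 1" "E c ** E (- c) = mat 1" for c
    by (simp_all add: E_def diag_matrix_def matrix_matrix_mult_def mat_def vec_eq_iff mult_delta_left
        mult_delta_right flip: exp_add cong: if_cong)
  \<comment> \<open>With \<open>c\<close> on the ray, \<open>W' c ** E (- c)\<close> is
    \<open>W c ** E (- c)\<close> times the conjugate of \<open>K\<close> considered here, and both
    of these products tend to 1.\<close>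
  have lim: "((\<lambda>r. (E (of_real r * cis s) ** K ** E (- (of_real r * cis s))) $ i $ j) \<longlongrightarrow> mat 1 $ i $ j) at_top"
    if s: "a < s" "s < b" for s i j
  proof (rule tendsto_mat_1_cancel)
    show "((\<lambda>r. (W (of_real r * cis s) ** E (- (of_real r * cis s))) $ i $ j) \<longlongrightarrow> mat 1 $ i $ j) at_top" for i j
      unfolding E_def by (rule sectorial_solution_tendsto[OF W Y s])
    show "((\<lambda>r. (W' (of_real r * cis s) ** E (- (of_real r * cis s))) $ i $ j) \<longlongrightarrow> mat 1 $ i $ j) at_top" for i j
      unfolding E_def by (rule sectorial_solution_tendsto[OF W' Y s])
    show "\<forall>\<^sub>F r in at_top. invertible (W (of_real r * cis s) ** E (- (of_real r * cis s))) \<and>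
        W' (of_real r * cis s) ** E (- (of_real r * cis s)) =
        W (of_real r * cis s) ** E (- (of_real r * cis s)) ** (E (of_real r * cis s) ** K ** E (- (of_real r * cis s)))"
      using eventually_gt_at_top[of 0]
    proof eventually_elim
      case (elim r)
      let ?c = "of_real r * cis s"
      have "invertible (E (- ?c))"
        unfolding invertible_def using E by blast
      moreover have "W ?c ** E (- ?c) ** (E ?c ** K ** E (- ?c)) = W ?c ** (E (- ?c) ** E ?c) ** K ** E (- ?c)"
        by (simp only: matrix_mul_assoc)
      ultimately show ?case
        using WK[OF elim s] by (simp add: E invertible_mult)
    qed
  qed
  have entry: "(E c ** K ** E (- c)) $ i $ j = K $ i $ j * exp (c * (snd Y $ i - snd Y $ j))" for c i j
    by (simp add: E_def diag_matrix_def matrix_matrix_mult_def mult_delta_left mult_delta_right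
        right_diff_distrib exp_diff exp_minus divide_inverse)
  have "K $ i $ j = mat 1 $ i $ j" for i j
  proof (cases "i = j")
    case True
    have "((\<lambda>r::real. K $ i $ j) \<longlongrightarrow> mat 1 $ i $ j) at_top"
      using lim[of t i j] t pi_gt_zero True by (simp add: entry)
    then show ?thesis
      by (simp add: tendsto_const_iff)
  next
    case False
    have "cis (t + pi) = - cis t"
      by (simp add: cis_mult[symmetric])
    then obtain s where s: "a < s" "s < b" and pos: "0 < Re (cis s * (snd Y $ i - snd Y $ j))"
    proof (cases "0 < Re (cis t * (snd Y $ i - snd Y $ j))")
      case True
      show ?thesis
        by (rule that[of t]) (use t pi_gt_zero True in linarith)+
    next
      case neg: False
      have "Re (cis (t + pi) * (snd Y $ i - snd Y $ j)) = - Re (cis t * (snd Y $ i - snd Y $ j))"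
        by (simp only: \<open>cis (t + pi) = - cis t\<close> mult_minus_left uminus_complex.sel)
      then show ?thesis
        by (intro that[of "t + pi"]) (use t pi_gt_zero neg re[OF False] in linarith)+
    qed
    \<comment> \<open>The constant is dominated by the conjugated entry, which tends to the
      off-diagonal entry 0 of \<open>mat 1\<close>.\<close>
    have "((\<lambda>r::real. K $ i $ j) \<longlongrightarrow> 0) at_top"
    proof (rule Lim_null_comparison)
      show "((\<lambda>r. norm (K $ i $ j * exp (of_real r * cis s * (snd Y $ i - snd Y $ j)))) \<longlongrightarrow> 0) at_top"
        using lim[OF s, of i j] False by (simp only: entry) (simp add: mat_def tendsto_norm_zero)
      show "\<forall>\<^sub>F r in at_top. norm (K $ i $ j) \<le> norm (K $ i $ j * exp (of_real r * cis s * (snd Y $ i - snd Y $ j)))"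
        using eventually_ge_at_top[of 0]
      proof eventually_elim
        case (elim r)
        have "Re (of_real r * cis s * (snd Y $ i - snd Y $ j)) = r * Re (cis s * (snd Y $ i - snd Y $ j))"
          by (simp add: algebra_simps)
        then have "0 \<le> Re (of_real r * cis s * (snd Y $ i - snd Y $ j))"
          using elim pos by simp
        then show ?case
          by (simp add: norm_mult mult_le_cancel_left1)
      qed
    qed
    then show ?thesis
      using False by (simp add: tendsto_const_iff mat_def)
  qed
  then have "K = mat 1"
    by (simp add: vec_eq_iff)
  then show ?thesis
    using WK(1) z by (auto simp: open_sector_def)
qed


section \<open>Uniqueness of the Stokes and central connection matrices\<close>

lemma small_angle_direction:
  assumes "small_angle \<phi> u \<epsilon>" "i \<noteq> j"
  shows "Re (cis \<phi> * (u $ i - u $ j)) \<noteq> 0"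
proof -
  have "admissible \<phi> u"
    using assms unfolding small_angle_def by auto
  moreover have "cis \<phi> \<in> line_at \<phi> - {0}"
    unfolding line_at_def by (auto intro!: exI[of _ 1])
  ultimately show ?thesis
    using assms(2) unfolding admissible_def by blast
qed

text \<open>\<delta> = pi gives the right sector and \<delta> = 0 the left one. The two openings may
  differ, so both solutions are restricted to the smaller. Agreement at the single point
  \<open>cis \<phi>\<close> suffices to compare constant matrices.\<close>

lemma sectorial_solution_unique_on_ray:
  fixes Y :: "'n::finite formal_matrix"
  assumes W: "sectorial_solution V Y (\<phi> - \<delta> - \<epsilon>) (\<phi> - \<delta> + pi + \<epsilon>) W"
    and W': "sectorial_solution V Y (\<phi> - \<delta> - \<epsilon>') (\<phi> - \<delta> + pi + \<epsilon>') W'"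
    and \<epsilon>: "small_angle \<phi> (snd Y) \<epsilon>" "small_angle \<phi> (snd Y) \<epsilon>'"
    and Y: "fst Y 0 = mat 1" and \<delta>: "\<delta> = 0 \<or> \<delta> = pi"
  shows "W' (cis \<phi>) = W (cis \<phi>)"
proof (rule sectorial_solution_unique[where a = "\<phi> - \<delta> - min \<epsilon> \<epsilon>'" and b = "\<phi> - \<delta> + pi + min \<epsilon> \<epsilon>'" and t = "\<phi> - \<delta>"])
  show "sectorial_solution V Y (\<phi> - \<delta> - min \<epsilon> \<epsilon>') (\<phi> - \<delta> + pi + min \<epsilon> \<epsilon>') W"
    "sectorial_solution V Y (\<phi> - \<delta> - min \<epsilon> \<epsilon>') (\<phi> - \<delta> + pi + min \<epsilon> \<epsilon>') W'"
    by (rule sectorial_solution_subsector[OF W]; simp)+ (rule sectorial_solution_subsector[OF W']; simp)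
  have pos: "0 < min \<epsilon> \<epsilon>'"
    using \<epsilon> by (simp add: small_angle_def)
  then show "\<phi> - \<delta> - min \<epsilon> \<epsilon>' < \<phi> - \<delta>" "\<phi> - \<delta> + pi < \<phi> - \<delta> + pi + min \<epsilon> \<epsilon>'"
    by simp_all
  show "Re (cis (\<phi> - \<delta>) * (snd Y $ i - snd Y $ j)) \<noteq> 0" if "i \<noteq> j" for i j
  proof -
    have "cis (\<phi> - \<delta>) = cis \<phi> \<or> cis (\<phi> - \<delta>) = - cis \<phi>"
      using \<delta> by (auto simp: cis_divide[symmetric])
    then show ?thesis
      using small_angle_direction[OF \<epsilon>(1) that]
      by (metis minus_mult_left neg_equal_0_iff_equal uminus_complex.sel(1))
  qed
  show "cis \<phi> \<in> open_sector (\<phi> - \<delta> - min \<epsilon> \<epsilon>') (\<phi> - \<delta> + pi + min \<epsilon> \<epsilon>')"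
    by (rule cis_in_open_sector) (use pos \<delta> pi_gt_zero in linarith)+
qed (rule Y)

lemma cis_in_plus_sector:
  assumes "small_angle \<phi> u \<epsilon>"
  shows "cis \<phi> \<in> open_sector (\<phi> - \<epsilon>) (\<phi> + \<epsilon>)"
  using assms by (intro cis_in_open_sector) (auto simp: small_angle_def)

text \<open>The sectorial solutions and openings are existentially quantified, separately for
  \<open>S\<close> and \<open>S'\<close>. At \<open>cis \<phi>\<close> the two choices agree, and
  the value of the right solution can be cancelled.\<close>

lemma stokes_matrix_unique:
  assumes "stokes_matrix cv cu h \<mu> Y \<phi> S" "stokes_matrix cv cu h \<mu> Y \<phi> S'"
    and Y: "normalized_formal_solution cv cu h \<mu> Y" and p: "p \<in> fst cu"
  shows "S = S'"
proof -
  let ?V = "V_matrix cv cu h \<mu> p"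
  note start = normalized_formal_solution_start[OF Y p]
  obtain \<epsilon> W Z where \<epsilon>: "small_angle \<phi> (snd cu p) \<epsilon>"
    and W: "sectorial_solution ?V (Y p) (\<phi> - pi - \<epsilon>) (\<phi> + \<epsilon>) W"
    and Z: "sectorial_solution ?V (Y p) (\<phi> - \<epsilon>) (\<phi> + pi + \<epsilon>) Z"
    and S: "\<And>z. z \<in> open_sector (\<phi> - \<epsilon>) (\<phi> + \<epsilon>) \<Longrightarrow> Z z = W z ** S"
    using assms(1) p unfolding stokes_matrix_def by blast
  obtain \<epsilon>' W' Z' where \<epsilon>': "small_angle \<phi> (snd cu p) \<epsilon>'"
    and W': "sectorial_solution ?V (Y p) (\<phi> - pi - \<epsilon>') (\<phi> + \<epsilon>') W'"
    and Z': "sectorial_solution ?V (Y p) (\<phi> - \<epsilon>') (\<phi> + pi + \<epsilon>') Z'"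
    and S': "\<And>z. z \<in> open_sector (\<phi> - \<epsilon>') (\<phi> + \<epsilon>') \<Longrightarrow> Z' z = W' z ** S'"
    using assms(2) p unfolding stokes_matrix_def by blast
  have "W' (cis \<phi>) = W (cis \<phi>)"
    using sectorial_solution_unique_on_ray[of ?V "Y p" \<phi> pi \<epsilon> W \<epsilon>' W'] W W' \<epsilon> \<epsilon>' start by simp
  moreover have "Z' (cis \<phi>) = Z (cis \<phi>)"
    using sectorial_solution_unique_on_ray[of ?V "Y p" \<phi> 0 \<epsilon> Z \<epsilon>' Z'] Z Z' \<epsilon> \<epsilon>' start by simp
  ultimately have "W (cis \<phi>) ** S = W (cis \<phi>) ** S'"
    using S[OF cis_in_plus_sector[OF \<epsilon>]] S'[OF cis_in_plus_sector[OF \<epsilon>']] by simp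
  moreover have "cis \<phi> \<in> open_sector (\<phi> - pi - \<epsilon>) (\<phi> + \<epsilon>)"
    using \<epsilon> pi_gt_zero by (intro cis_in_open_sector) (auto simp: small_angle_def)
  then have "invertible (W (cis \<phi>))"
    using W unfolding sectorial_solution_def by blast
  ultimately show ?thesis
    using invertible_mult_left_cancel by blast
qed

text \<open>Here the factor to cancel is the solution \<open>X\<close> from the origin. It is
  invertible because \<open>X ** C\<close> is a value of a fundamental solution, which gives
  \<open>X\<close> a right inverse.\<close>

lemma central_connection_matrix_unique:
  assumes "central_connection_matrix F cv cu h \<mu> R \<theta> Y \<phi> C" "central_connection_matrix F cv cu h \<mu> R \<theta> Y \<phi> C'"
    and Y: "normalized_formal_solution cv cu h \<mu> Y" and p: "p \<in> fst cu"
  shows "C = C'"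
proof -
  let ?V = "V_matrix cv cu h \<mu> p"
  note start = normalized_formal_solution_start[OF Y p]
  define X where "X = Psi cv cu h p ** Y_origin (Theta_of F cv \<theta>) \<mu> R p (log_branch \<phi> (cis \<phi>))"
  obtain \<epsilon> W where \<epsilon>: "small_angle \<phi> (snd cu p) \<epsilon>"
    and W: "sectorial_solution ?V (Y p) (\<phi> - pi - \<epsilon>) (\<phi> + \<epsilon>) W"
    and C: "W (cis \<phi>) = X ** C"
    using assms(1) p cis_in_plus_sector unfolding central_connection_matrix_def X_def by blast
  obtain \<epsilon>' W' where \<epsilon>': "small_angle \<phi> (snd cu p) \<epsilon>'"
    and W': "sectorial_solution ?V (Y p) (\<phi> - pi - \<epsilon>') (\<phi> + \<epsilon>') W'"
    and C': "W' (cis \<phi>) = X ** C'"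
    using assms(2) p cis_in_plus_sector unfolding central_connection_matrix_def X_def by blast
  have "W' (cis \<phi>) = W (cis \<phi>)"
    using sectorial_solution_unique_on_ray[of ?V "Y p" \<phi> pi \<epsilon> W \<epsilon>' W'] W W' \<epsilon> \<epsilon>' start by simp
  then have "X ** C = X ** C'"
    by (simp add: C C')
  moreover have "cis \<phi> \<in> open_sector (\<phi> - pi - \<epsilon>) (\<phi> + \<epsilon>)"
    using \<epsilon> pi_gt_zero by (intro cis_in_open_sector) (auto simp: small_angle_def)
  then have "invertible (X ** C)"
    using W C unfolding sectorial_solution_def by metis
  then have "X ** (C ** matrix_inv (X ** C)) = mat 1"
    using matrix_inv_mult(1) by (simp add: matrix_mul_assoc)
  then have "invertible X"
    unfolding invertible_right_inverse by blast
  ultimately show ?thesis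
    using invertible_mult_left_cancel by blast
qed

text \<open>The coordinates enumerate as many distinct eigenvalues as there are indices, so none
  repeats.\<close>

lemma regular_part_distinct_coordinates:
  fixes M :: "('m, 'n::finite) frobenius_data"
  assumes "p \<in> regular_part M" "canonical_coordinates M c" "p \<in> fst c"
  shows "inj (\<lambda>i. snd c p $ i)"
proof -
  have "card (range (\<lambda>i. snd c p $ i)) = CARD('n)"
    using assms unfolding regular_part_def canonical_coordinates_def by auto
  then show ?thesis
    by (simp add: eq_card_imp_inj_on)
qed


section \<open>Invariance of the monodromy data\<close>

theorem theorem2:
  fixes M Mh :: "('m, 'n::finite) frobenius_data"
    and D :: complex
    and B :: "'m set"
    and v vh u :: "'m \<Rightarrow> complex^'n"
    and \<iota> \<kappa> :: 'n
    and \<eta> R :: "complex^'n^'n"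
    and \<mu> r :: "complex^'n"
    and Rs :: "nat \<Rightarrow> complex^'n^'n"
    and \<Theta> :: "'m \<Rightarrow> complex \<Rightarrow> complex^'n^'n"
    and \<theta> \<theta>h :: "'n \<Rightarrow> nat \<Rightarrow> 'm \<Rightarrow> complex"
    and \<Omega> :: "'n \<Rightarrow> nat \<Rightarrow> 'n \<Rightarrow> nat \<Rightarrow> 'm \<Rightarrow> complex"
    and h hh :: "'m \<Rightarrow> complex^'n"
    and Y Yh :: "'m \<Rightarrow> 'n formal_matrix"
  assumes M: "frobenius_manifold M D" "semisimple M"
    and flat: "flat_coordinates M D (B, v) \<iota> \<eta> \<mu> r"
    and monodromy: "monodromy_data M (B, v) \<eta> \<mu> R Rs \<Theta>"
    and calib: "calibration M (B, v) \<iota> \<eta> \<mu> Rs \<Theta> \<theta>"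
    and two_point: "two_point_functions M (B, v) \<eta> \<theta> \<Omega>"
    and regular: "B \<subseteq> regular_part M"
    and canonical: "canonical_coordinates M (B, u)"
    and frame: "normalizing_factors M (B, u) h"
    and invertible: "\<forall>p\<in>B. invertible (sc M (B, v) p \<kappa>)"
    and Mh: "Mh = S_kappa M (B, v) \<kappa>"
    and vh: "vh = S_kappa_coordinates \<eta> \<Omega> \<kappa>" "(B, vh) \<in> charts Mh"
    and \<theta>h: "\<theta>h = S_kappa_calibration \<Omega> \<kappa>"
    and hh: "hh = S_kappa_factors (B, v) (B, u) h \<kappa>"
    and Y: "normalized_formal_solution (B, v) (B, u) h \<mu> Y"
    and Yh: "normalized_formal_solution (B, vh) (B, u) hh \<mu> Yh"
  shows "(\<forall>p\<in>B. Y p = Yh p) \<and>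
    (\<forall>\<phi>. 0 \<le> \<phi> \<and> \<phi> < 2 * pi \<and> (\<forall>p\<in>B. admissible \<phi> (u p)) \<longrightarrow>
       (\<forall>S. stokes_matrix (B, v) (B, u) h \<mu> Y \<phi> S \<longrightarrow>
          (\<forall>Sh. stokes_matrix (B, vh) (B, u) hh \<mu> Yh \<phi> Sh \<longleftrightarrow> Sh = S)) \<and>
       (\<forall>C. central_connection_matrix M (B, v) (B, u) h \<mu> R \<theta> Y \<phi> C \<longrightarrow>
          (\<forall>Ch. central_connection_matrix Mh (B, vh) (B, u) hh \<mu> R \<theta>h Yh \<phi> Ch \<longleftrightarrow> Ch = C)))"
proof -
  interpret calibrated_chart M D B v \<iota> \<kappa> \<eta> \<mu> r Rs \<Theta> \<theta> \<Omega>
    using M(1) flat calib two_point invertible by unfold_locales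
  have vhM: "(B, S_kappa_coordinates \<eta> \<Omega> \<kappa>) \<in> charts M"
    using vh Mh by (simp add: S_kappa_def)
  have Psi: "Psi (B, vh) (B, u) hh p = Psi (B, v) (B, u) h p" if "p \<in> B" for p
    unfolding vh(1) hh by (rule Psi_S_kappa[OF canonical frame that])
  have V: "V_matrix (B, vh) (B, u) hh \<mu> p = V_matrix (B, v) (B, u) h \<mu> p" if "p \<in> B" for p
    by (simp add: V_matrix_def Psi[OF that])
  have Theta: "Y_origin (Theta_of Mh (B, vh) \<theta>h) \<mu> R p l = Y_origin (Theta_of M (B, v) \<theta>) \<mu> R p l"
    if "p \<in> B" for p l
    by (simp add: Y_origin_def vh(1) Mh \<theta>h Theta_S_kappa[OF vhM that])
  have Y_eq: "Yh p = Y p" if "p \<in> B" for p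
  proof (rule normalized_formal_solution_unique[OF Yh Y])
    show "inj (\<lambda>i. snd (B, u) p $ i)"
      by (rule regular_part_distinct_coordinates[OF _ canonical]) (use regular that in auto)
  qed (use that V in auto)
  \<comment> \<open>Uniqueness of the constant matrices needs a point of \<open>B\<close>; the
    centre of the coordinate ball provides one.\<close>
  obtain a \<rho> where "0 < \<rho>" "v ` B = ball a \<rho>"
    using flat unfolding flat_coordinates_def by auto
  then have "a \<in> v ` B"
    by simp
  then obtain p where p: "p \<in> fst (B, u)"
    by auto
  \<comment> \<open>The defining conditions for the two manifolds coincide at every point, so the
    final equivalences reduce to uniqueness for \<open>M\<close>.\<close>
  have stokes: "stokes_matrix (B, vh) (B, u) hh \<mu> Yh \<phi> S \<longleftrightarrow> stokes_matrix (B, v) (B, u) h \<mu> Y \<phi> S"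
    for \<phi> S
    unfolding stokes_matrix_def fst_conv by (intro ball_cong refl) (simp only: V Y_eq)
  have central: "central_connection_matrix Mh (B, vh) (B, u) hh \<mu> R \<theta>h Yh \<phi> C
      \<longleftrightarrow> central_connection_matrix M (B, v) (B, u) h \<mu> R \<theta> Y \<phi> C" for \<phi> C
    unfolding central_connection_matrix_def fst_conv
    by (intro ball_cong refl) (simp only: V Y_eq Psi Theta)
  show ?thesis
    unfolding stokes central
    by (intro conjI allI impI ballI iffI)
      (auto simp: Y_eq intro: stokes_matrix_unique[OF _ _ Y p] central_connection_matrix_unique[OF _ _ Y p])
qed

end
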